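(* Let $B\subset \mathbb{R}^n$ be the open unit ball (centered at the origin) and let $f:B\to \mathbb{R}$ be a (not necessarily continuous) function. Assume that $n\geq 3$ and that the restriction $f|_{S^2}$ is real analytic for every 2-sphere $S^2\subset B$ passing through the origin. Then $f$ is real analytic on $B$.
   Context: "2-sphere passing through the origin" is used in the most restrictive sense: it is a (round, non-degenerate) 2-sphere in $\mathbb{R}^n$ that is the intersection of an $(n-1)$-sphere of the form $\bigl(\sum_i x_i^2=\sum_i c_ix_i\bigr)$, with $c_1,\dots,c_n\in\mathbb{R}$, with a vector subspace of $\mathbb{R}^n$ of dimension 3. *)

theory Defs
  imports "HOL-Analysis.Analysis"
begin

text \<open>
  Multi-indices are functions \<open>\<alpha> :: 'n \<Rightarrow> nat\<close>. The sum over all of them is unordered, so convergence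
  is absolute convergence of the multivariate power series.
\<close>

definition real_analytic_at :: "(real ^ 'n \<Rightarrow> real) \<Rightarrow> real ^ 'n \<Rightarrow> bool" where
  "real_analytic_at f a \<longleftrightarrow>
     (\<exists>r>0. \<exists>c :: ('n \<Rightarrow> nat) \<Rightarrow> real. \<forall>x\<in>ball a r.
        ((\<lambda>\<alpha>. c \<alpha> * (\<Prod>i\<in>UNIV. (x $ i - a $ i) ^ \<alpha> i)) has_sum f x) UNIV)"

definition real_analytic_on :: "(real ^ 'n \<Rightarrow> real) \<Rightarrow> (real ^ 'n) set \<Rightarrow> bool" where
  "real_analytic_on f U \<longleftrightarrow> (\<forall>a\<in>U. real_analytic_at f a)"

text \<open>
  Analyticity of the restriction of \<open>f\<close> to a subset \<open>S\<close> of Euclidean space, meant for embedded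
  analytic submanifolds \<open>S\<close>: near each point of \<open>S\<close>, \<open>f\<close> agrees on \<open>S\<close> with a function that is
  analytic on an open subset of the ambient space. Only the values of \<open>f\<close> on \<open>S\<close> matter.
\<close>

definition restriction_real_analytic :: "(real ^ 'n \<Rightarrow> real) \<Rightarrow> (real ^ 'n) set \<Rightarrow> bool" where
  "restriction_real_analytic f S \<longleftrightarrow>
     (\<forall>p\<in>S. \<exists>U g. open U \<and> p \<in> U \<and> real_analytic_on g U \<and> (\<forall>x\<in>S \<inter> U. g x = f x))"

definition round_2_sphere :: "(real ^ 'n) set \<Rightarrow> bool" where
  "round_2_sphere S \<longleftrightarrow>
     (\<exists>A p r. affine A \<and> aff_dim A = 3 \<and> p \<in> A \<and> r > 0 \<and> S = sphere p r \<inter> A)"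

text \<open>
  The first conjunct excludes the degenerate intersection \<open>{0}\<close>, which arises when \<open>c\<close> is
  orthogonal to \<open>V\<close> (in particular when \<open>c = 0\<close>).
\<close>

definition two_sphere_through_origin :: "(real ^ 'n) set \<Rightarrow> bool" where
  "two_sphere_through_origin S \<longleftrightarrow>
     round_2_sphere S \<and>
     (\<exists>(c :: real ^ 'n) V. subspace V \<and> dim V = 3 \<and>
        S = {x. (\<Sum>i\<in>UNIV. (x $ i)\<^sup>2) = (\<Sum>i\<in>UNIV. c $ i * x $ i)} \<inter> V)"

end

theory Submission
  imports Defs "HOL-Complex_Analysis.Cauchy_Integral_Formula"
begin

text \<open>
  Inversion at the origin turns the 2-spheres through the origin inside \<open>B\<close> into the affine 2-planes
  missing the closed unit ball. Fix a point \<open>y\<close> outside that ball. On a 2-plane through \<open>y\<close> the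
  transformed function \<open>g\<close> is a convergent series of homogeneous polynomials, and its degree-\<open>k\<close> part
  along a line depends only on the line. Hence the \<open>k\<close>-th Taylor coefficient of \<open>g\<close> along lines,
  as a function of the direction, is a polynomial of degree at most \<open>k\<close> on many lines, so by Lagrange
  interpolation a polynomial on a small cube of directions. A Baire category argument
  bounds these coefficients geometrically on a smaller cube, and interpolation carries the bound
  over to all directions. So the homogeneous polynomials sum to an
  analytic function \<open>F\<close>, which agrees with \<open>g\<close> on an open cone near \<open>y\<close>. Every point near
  \<open>y\<close> is joined to this cone by a line missing the unit ball, and the one-variable identity
  theorem on that line gives \<open>g = F\<close> near \<open>y\<close>. This settles all points other than the origin.

  At the origin the same argument is applied in the coordinates \<open>w\<close> given by
  \<open>x = inv (y + inv w)\<close> with \<open>|y| > 1\<close>, in which 2-planes through \<open>0\<close> that are nearly orthogonal to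
  \<open>y\<close> become 2-spheres through the origin. Here \<open>g = F\<close> spreads from the cone to a full
  neighbourhood along segments avoiding \<open>0\<close>, where \<open>f\<close> is already known to be analytic.
\<close>

subsection \<open>Absolutely convergent power series on polydiscs\<close>

definition monomial_at :: "real ^ 'n \<Rightarrow> ('n \<Rightarrow> nat) \<Rightarrow> real" where
  "monomial_at x \<alpha> = (\<Prod>i\<in>UNIV. (x $ i) ^ \<alpha> i)"

abbreviation deg :: "('n::finite \<Rightarrow> nat) \<Rightarrow> nat" where
  "deg \<alpha> \<equiv> sum \<alpha> UNIV"

text \<open>The weighted \<open>\<ell>\<^sup>1\<close> norm of the coefficients is submultiplicative; all convergence
  and growth estimates below go through the bound \<open>N\<close> on it.\<close>

definition polydisc_series_with :: "(('n::finite \<Rightarrow> nat) \<Rightarrow> real) \<Rightarrow> real \<Rightarrow> real \<Rightarrow> (real ^ 'n \<Rightarrow> real) \<Rightarrow> bool" where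
  "polydisc_series_with c \<rho> N u \<longleftrightarrow>
     (\<exists>M\<le>N. ((\<lambda>\<alpha>. \<bar>c \<alpha>\<bar> * \<rho> ^ deg \<alpha>) has_sum M) UNIV) \<and>
     (\<forall>x. (\<forall>i. \<bar>x $ i\<bar> \<le> \<rho>) \<longrightarrow> ((\<lambda>\<alpha>. c \<alpha> * monomial_at x \<alpha>) has_sum u x) UNIV)"

definition polydisc_series :: "real \<Rightarrow> real \<Rightarrow> (real ^ 'n \<Rightarrow> real) \<Rightarrow> bool" where
  "polydisc_series \<rho> N u \<longleftrightarrow> (\<exists>c. polydisc_series_with c \<rho> N u)"

lemma monomial_at_const: "monomial_at (\<chi> i. \<rho>) \<alpha> = \<rho> ^ deg \<alpha>"
  by (simp add: monomial_at_def power_sum)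

lemma monomial_at_abs_le:
  assumes "\<forall>i. \<bar>x $ i\<bar> \<le> \<rho>"
  shows "\<bar>monomial_at x \<alpha>\<bar> \<le> \<rho> ^ deg \<alpha>"
  unfolding monomial_at_def abs_prod power_sum
  by (rule prod_mono) (use assms in \<open>auto simp: power_abs intro: power_mono\<close>)

lemma monomial_at_add: "monomial_at x (\<lambda>i. \<alpha> i + \<beta> i) = monomial_at x \<alpha> * monomial_at x \<beta>"
  by (simp add: monomial_at_def power_add prod.distrib)

lemma monomial_at_scale: "monomial_at (t *\<^sub>R x) \<alpha> = t ^ deg \<alpha> * monomial_at x \<alpha>"
  by (simp add: monomial_at_def power_mult_distrib prod.distrib power_sum)

lemma monomial_at_zero: "monomial_at 0 \<alpha> = (if \<alpha> = (\<lambda>_. 0) then 1 else 0)"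
proof (cases "\<alpha> = (\<lambda>_. 0)")
  case False
  then obtain i where "\<alpha> i \<noteq> 0" by auto
  then show ?thesis using False unfolding monomial_at_def
    by (simp add: power_0_left prod_zero_iff) blast
qed (simp add: monomial_at_def)

lemma polydisc_series_with_polydisc_series: "polydisc_series_with c \<rho> N u \<Longrightarrow> polydisc_series \<rho> N u"
  by (auto simp: polydisc_series_def)

lemma polydisc_series_with_mono: "polydisc_series_with c \<rho> N u \<Longrightarrow> N \<le> M \<Longrightarrow> polydisc_series_with c \<rho> M u"
  unfolding polydisc_series_with_def by (meson order_trans)

lemma polydisc_series_mono: "polydisc_series \<rho> N u \<Longrightarrow> N \<le> M \<Longrightarrow> polydisc_series \<rho> M u"
  unfolding polydisc_series_def using polydisc_series_with_mono by blast

lemma polydisc_series_with_abs_le: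
  assumes "polydisc_series_with c \<rho> N u" "\<forall>i. \<bar>x $ i\<bar> \<le> \<rho>"
  shows "\<bar>u x\<bar> \<le> N"
proof -
  obtain M where M: "M \<le> N" "((\<lambda>\<alpha>. \<bar>c \<alpha>\<bar> * \<rho> ^ deg \<alpha>) has_sum M) UNIV"
    and u: "((\<lambda>\<alpha>. c \<alpha> * monomial_at x \<alpha>) has_sum u x) UNIV"
    using assms unfolding polydisc_series_with_def by blast
  have le: "\<bar>c \<alpha> * monomial_at x \<alpha>\<bar> \<le> \<bar>c \<alpha>\<bar> * \<rho> ^ deg \<alpha>" for \<alpha>
    using monomial_at_abs_le[OF assms(2)] by (simp add: abs_mult mult_left_mono)
  have "u x \<le> M"
    by (rule has_sum_mono[OF u M(2)]) (use le abs_le_iff in blast)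
  moreover have "- u x \<le> M"
    by (rule has_sum_mono[OF has_sum_uminusI[OF u] M(2)]) (use le abs_le_iff in blast)
  ultimately show ?thesis using M(1) by linarith
qed

lemma polydisc_series_abs_le: "polydisc_series \<rho> N u \<Longrightarrow> \<forall>i. \<bar>x $ i\<bar> \<le> \<rho> \<Longrightarrow> \<bar>u x\<bar> \<le> N"
  unfolding polydisc_series_def using polydisc_series_with_abs_le by blast

lemma polydisc_series_nonneg: "polydisc_series \<rho> N u \<Longrightarrow> 0 \<le> \<rho> \<Longrightarrow> 0 \<le> N"
  using polydisc_series_abs_le[of \<rho> N u 0] by fastforce

text \<open>The common source of the closure properties below: the double family of coefficients is
  absolutely summable with the weights \<open>\<rho> ^ deg \<alpha>\<close>, so Fubini lets the sums
  over \<open>k\<close> and over multi-indices be exchanged, and the weighted norms add up.\<close>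

lemma polydisc_series_has_sum:
  assumes "0 < \<rho>"
    and "\<And>k. k \<in> K \<Longrightarrow> polydisc_series \<rho> (N k) (u k)"
    and "(N has_sum M) K"
    and "\<And>x. (\<forall>i. \<bar>x $ i\<bar> \<le> \<rho>) \<Longrightarrow> ((\<lambda>k. u k x) has_sum v x) K"
  shows "polydisc_series \<rho> M v"
proof -
  have "\<forall>k\<in>K. \<exists>c. polydisc_series_with c \<rho> (N k) (u k)"
    using assms(2) by (auto simp: polydisc_series_def)
  then obtain c where c: "\<And>k. k \<in> K \<Longrightarrow> polydisc_series_with (c k) \<rho> (N k) (u k)"
    by metis
  define S where "S k = infsum (\<lambda>\<alpha>. \<bar>c k \<alpha>\<bar> * \<rho> ^ deg \<alpha>) UNIV" for k
  have S: "((\<lambda>\<alpha>. \<bar>c k \<alpha>\<bar> * \<rho> ^ deg \<alpha>) has_sum S k) UNIV" and SN: "S k \<le> N k" if "k \<in> K" for k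
    using c[OF that] unfolding polydisc_series_with_def S_def by (auto dest: infsumI)
  have S0: "0 \<le> S k" if "k \<in> K" for k
    unfolding S_def using assms(1) by (intro infsum_nonneg) auto
  have "S summable_on K"
    by (rule summable_on_comparison_test[OF has_sum_imp_summable[OF assms(3)]]) (use SN S0 in auto)
  \<comment> \<open>Joint summability of the weighted coefficients dominates every rearrangement
    made below, for the limit coefficients \<open>C\<close> as well as for the values at a
    point.\<close>
  then have big: "(\<lambda>(k,\<alpha>). \<bar>c k \<alpha>\<bar> * \<rho> ^ deg \<alpha>) summable_on K \<times> UNIV"
    by (intro summable_on_SigmaI[where g=S]) (use S assms(1) in auto)
  then have big': "(\<lambda>(\<alpha>,k). \<bar>c k \<alpha>\<bar> * \<rho> ^ deg \<alpha>) summable_on UNIV \<times> K"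
    by (subst summable_on_swap) (simp add: case_prod_unfold)
  have row: "(\<lambda>k. \<bar>c k \<alpha>\<bar> * \<rho> ^ deg \<alpha>) summable_on K" for \<alpha>
    using summable_on_SigmaD1[OF big'] by simp
  have row': "(\<lambda>k. \<bar>c k \<alpha>\<bar>) summable_on K" for \<alpha>
    using summable_on_cmult_left[OF row[of \<alpha>], of "inverse (\<rho> ^ deg \<alpha>)"] assms(1)
    by (simp add: mult.assoc)
  then have "(\<lambda>k. c k \<alpha>) summable_on K" for \<alpha>
    by (simp add: abs_summable_summable)
  define C where "C \<alpha> = infsum (\<lambda>k. c k \<alpha>) K" for \<alpha>
  have C: "((\<lambda>k. c k \<alpha>) has_sum C \<alpha>) K" for \<alpha>
    unfolding C_def using \<open>(\<lambda>k. c k \<alpha>) summable_on K\<close> by simp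
  define R where "R \<alpha> = infsum (\<lambda>k. \<bar>c k \<alpha>\<bar> * \<rho> ^ deg \<alpha>) K" for \<alpha>
  have R: "((\<lambda>k. \<bar>c k \<alpha>\<bar> * \<rho> ^ deg \<alpha>) has_sum R \<alpha>) K" for \<alpha>
    unfolding R_def using row by simp
  obtain T where T: "((\<lambda>(k,\<alpha>). \<bar>c k \<alpha>\<bar> * \<rho> ^ deg \<alpha>) has_sum T) (K \<times> UNIV)"
    using big by (auto simp: summable_on_def)
  then have T': "((\<lambda>(\<alpha>,k). \<bar>c k \<alpha>\<bar> * \<rho> ^ deg \<alpha>) has_sum T) (UNIV \<times> K)"
    by (subst has_sum_swap) (simp add: case_prod_unfold)
  have ST: "(S has_sum T) K"
    by (rule has_sum_SigmaD[OF T]) (use S in auto)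
  have RT: "(R has_sum T) UNIV"
    by (rule has_sum_SigmaD[OF T']) (use R in auto)
  have "T \<le> M" by (rule has_sum_mono[OF ST assms(3)]) (rule SN)
  \<comment> \<open>The triangle inequality for infinite sums, obtained by comparing both signs of
    \<open>C \<alpha>\<close> with \<open>R \<alpha>\<close>.\<close>
  have CR: "\<bar>C \<alpha>\<bar> * \<rho> ^ deg \<alpha> \<le> R \<alpha>" for \<alpha>
  proof -
    have 1: "((\<lambda>k. c k \<alpha> * \<rho> ^ deg \<alpha>) has_sum C \<alpha> * \<rho> ^ deg \<alpha>) K"
      by (rule has_sum_cmult_left[OF C])
    have 2: "\<bar>c k \<alpha> * \<rho> ^ deg \<alpha>\<bar> \<le> \<bar>c k \<alpha>\<bar> * \<rho> ^ deg \<alpha>" for k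
      using assms(1) by (simp add: abs_mult)
    have "C \<alpha> * \<rho> ^ deg \<alpha> \<le> R \<alpha>"
      by (rule has_sum_mono[OF 1 R]) (rule abs_le_D1[OF 2])
    moreover have "- (C \<alpha> * \<rho> ^ deg \<alpha>) \<le> R \<alpha>"
      by (rule has_sum_mono[OF has_sum_uminusI[OF 1] R]) (rule abs_le_D2[OF 2])
    ultimately show ?thesis using assms(1) by (simp add: abs_if)
  qed
  have Csum: "(\<lambda>\<alpha>. \<bar>C \<alpha>\<bar> * \<rho> ^ deg \<alpha>) summable_on UNIV"
    by (rule summable_on_comparison_test[OF has_sum_imp_summable[OF RT]]) (use CR assms(1) in auto)
  have "((\<lambda>\<alpha>. C \<alpha> * monomial_at x \<alpha>) has_sum v x) UNIV" if x: "\<forall>i. \<bar>x $ i\<bar> \<le> \<rho>" for x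
  proof -
    have le: "\<bar>c k \<alpha> * monomial_at x \<alpha>\<bar> \<le> \<bar>c k \<alpha>\<bar> * \<rho> ^ deg \<alpha>" for k \<alpha>
      using monomial_at_abs_le[OF x] by (simp add: abs_mult mult_left_mono)
    have "(\<lambda>(k,\<alpha>). c k \<alpha> * monomial_at x \<alpha>) summable_on K \<times> UNIV"
      by (rule abs_summable_summable, rule Infinite_Sum.abs_summable_on_comparison_test'[OF big])
         (use le in auto)
    moreover have "((\<lambda>\<alpha>. c k \<alpha> * monomial_at x \<alpha>) has_sum u k x) UNIV" if "k \<in> K" for k
      using c[OF that] x unfolding polydisc_series_with_def by blast
    ultimately have "((\<lambda>(k,\<alpha>). c k \<alpha> * monomial_at x \<alpha>) has_sum v x) (K \<times> UNIV)"
      by (intro has_sum_SigmaI[OF _ assms(4)[OF x]]) auto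
    then have *: "((\<lambda>(\<alpha>,k). c k \<alpha> * monomial_at x \<alpha>) has_sum v x) (UNIV \<times> K)"
      by (subst has_sum_swap) (simp add: case_prod_unfold)
    show ?thesis
      by (rule has_sum_SigmaD[OF *]) (auto intro: has_sum_cmult_left C)
  qed
  moreover have "\<exists>M'\<le>M. ((\<lambda>\<alpha>. \<bar>C \<alpha>\<bar> * \<rho> ^ deg \<alpha>) has_sum M') UNIV"
    using order_trans[OF has_sum_mono[OF has_sum_infsum[OF Csum] RT CR] \<open>T \<le> M\<close>]
      has_sum_infsum[OF Csum] by blast
  ultimately show ?thesis unfolding polydisc_series_def polydisc_series_with_def by blast
qed

section \<open>Sums, products and substitution for polydisc series\<close>

lemma polydisc_series_sum:
  assumes "0 < \<rho>" "finite K" "\<And>k. k \<in> K \<Longrightarrow> polydisc_series \<rho> (N k) (u k)"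
  shows "polydisc_series \<rho> (sum N K) (\<lambda>x. \<Sum>k\<in>K. u k x)"
  by (rule polydisc_series_has_sum[OF assms(1), where K=K and N=N and u=u])
     (use assms in \<open>auto intro: has_sum_finite\<close>)

lemma polydisc_series_monomial_at:
  assumes "0 < \<rho>"
  shows "polydisc_series \<rho> (\<bar>a\<bar> * \<rho> ^ deg \<gamma>) (\<lambda>x. a * monomial_at x \<gamma>)"
  unfolding polydisc_series_def polydisc_series_with_def
proof (intro exI[of _ "\<lambda>\<alpha>. if \<alpha> = \<gamma> then a else 0"] conjI allI impI)
  show "\<exists>M\<le>\<bar>a\<bar> * \<rho> ^ deg \<gamma>. ((\<lambda>\<alpha>. \<bar>if \<alpha> = \<gamma> then a else 0\<bar> * \<rho> ^ deg \<alpha>) has_sum M) UNIV"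
    by (intro exI[of _ "\<bar>a\<bar> * \<rho> ^ deg \<gamma>"] conjI order_refl has_sum_finite_neutralI[of "{\<gamma>}"]) auto
  show "((\<lambda>\<alpha>. (if \<alpha> = \<gamma> then a else 0) * monomial_at x \<alpha>) has_sum a * monomial_at x \<gamma>) UNIV" for x
    by (intro has_sum_finite_neutralI[of "{\<gamma>}"]) auto
qed

lemma polydisc_series_const: "0 < \<rho> \<Longrightarrow> polydisc_series \<rho> \<bar>a\<bar> (\<lambda>x. a)"
  using polydisc_series_monomial_at[of \<rho> a "\<lambda>_. 0"] by (simp add: monomial_at_def)

lemma polydisc_series_component:
  fixes i :: "'n::finite"
  assumes "0 < \<rho>"
  shows "polydisc_series \<rho> \<rho> (\<lambda>x. x $ i)"
proof -
  define \<gamma> :: "'n \<Rightarrow> nat" where "\<gamma> j = (if j = i then 1 else 0)" for j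
  have "monomial_at x \<gamma> = x $ i" for x :: "real^'n"
    unfolding monomial_at_def by (subst prod.remove[of _ i]) (auto simp: \<gamma>_def intro: prod.neutral)
  moreover have "deg \<gamma> = 1" by (simp add: \<gamma>_def)
  ultimately show ?thesis using polydisc_series_monomial_at[OF assms, of 1 \<gamma>] by simp
qed

text \<open>Multiplying by a monomial only shifts exponents. This is half of the product rule: the
  other factor is then expanded into monomials, which avoids writing down Cauchy product
  coefficients.\<close>

lemma polydisc_series_monomial_at_mult:
  fixes u :: "real^'n \<Rightarrow> real"
  assumes "0 < \<rho>" "polydisc_series \<rho> N u"
  shows "polydisc_series \<rho> (\<bar>a\<bar> * \<rho> ^ deg \<gamma> * N) (\<lambda>x. a * monomial_at x \<gamma> * u x)"
proof -
  obtain c M where c: "M \<le> N" "((\<lambda>\<alpha>. \<bar>c \<alpha>\<bar> * \<rho> ^ deg \<alpha>) has_sum M) UNIV"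
    "\<And>x. (\<forall>i. \<bar>x $ i\<bar> \<le> \<rho>) \<Longrightarrow> ((\<lambda>\<alpha>. c \<alpha> * monomial_at x \<alpha>) has_sum u x) UNIV"
    using assms(2) unfolding polydisc_series_def polydisc_series_with_def by blast
  show ?thesis
  proof (rule polydisc_series_has_sum[OF assms(1), where K=UNIV and N="\<lambda>\<alpha>. \<bar>a * c \<alpha>\<bar> * \<rho> ^ deg (\<lambda>i. \<gamma> i + \<alpha> i)"
        and u="\<lambda>\<alpha> x. (a * c \<alpha>) * monomial_at x (\<lambda>i. \<gamma> i + \<alpha> i)", THEN polydisc_series_mono])
    show "((\<lambda>\<alpha>. \<bar>a * c \<alpha>\<bar> * \<rho> ^ deg (\<lambda>i. \<gamma> i + \<alpha> i)) has_sum \<bar>a\<bar> * \<rho> ^ deg \<gamma> * M) UNIV"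
      using has_sum_cmult_right[OF c(2), of "\<bar>a\<bar> * \<rho> ^ deg \<gamma>"]
      by (simp add: abs_mult sum.distrib power_add mult_ac)
    show "\<bar>a\<bar> * \<rho> ^ deg \<gamma> * M \<le> \<bar>a\<bar> * \<rho> ^ deg \<gamma> * N"
      using c(1) assms(1) by (intro mult_left_mono) auto
    show "((\<lambda>\<alpha>. a * c \<alpha> * monomial_at x (\<lambda>i. \<gamma> i + \<alpha> i)) has_sum a * monomial_at x \<gamma> * u x) UNIV"
      if "\<forall>i. \<bar>x $ i\<bar> \<le> \<rho>" for x
      using has_sum_cmult_right[OF c(3)[OF that], of "a * monomial_at x \<gamma>"]
      by (simp add: monomial_at_add mult_ac)
  qed (rule polydisc_series_monomial_at[OF assms(1)])
qed

lemma polydisc_series_mult: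
  assumes "0 < \<rho>" "polydisc_series \<rho> N u" "polydisc_series \<rho> L v"
  shows "polydisc_series \<rho> (N * L) (\<lambda>x. u x * v x)"
proof -
  obtain c M where c: "M \<le> L" "((\<lambda>\<alpha>. \<bar>c \<alpha>\<bar> * \<rho> ^ deg \<alpha>) has_sum M) UNIV"
    "\<And>x. (\<forall>i. \<bar>x $ i\<bar> \<le> \<rho>) \<Longrightarrow> ((\<lambda>\<alpha>. c \<alpha> * monomial_at x \<alpha>) has_sum v x) UNIV"
    using assms(3) unfolding polydisc_series_def polydisc_series_with_def by blast
  have "0 \<le> N" using polydisc_series_nonneg assms by fastforce
  show ?thesis
  proof (rule polydisc_series_has_sum[OF assms(1), where K=UNIV and N="\<lambda>\<alpha>. \<bar>c \<alpha>\<bar> * \<rho> ^ deg \<alpha> * N"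
        and u="\<lambda>\<alpha> x. c \<alpha> * monomial_at x \<alpha> * u x", THEN polydisc_series_mono])
    show "((\<lambda>\<alpha>. \<bar>c \<alpha>\<bar> * \<rho> ^ deg \<alpha> * N) has_sum M * N) UNIV"
      by (rule has_sum_cmult_left[OF c(2)])
    show "M * N \<le> N * L" using mult_left_mono[OF c(1) \<open>0 \<le> N\<close>] by (simp add: mult.commute)
    show "((\<lambda>\<alpha>. c \<alpha> * monomial_at x \<alpha> * u x) has_sum u x * v x) UNIV"
      if "\<forall>i. \<bar>x $ i\<bar> \<le> \<rho>" for x
      using has_sum_cmult_left[OF c(3)[OF that], of "u x"] by (simp add: mult.commute)
  qed (rule polydisc_series_monomial_at_mult[OF assms(1,2)])
qed

lemma polydisc_series_power:
  assumes "0 < \<rho>" "polydisc_series \<rho> N u"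
  shows "polydisc_series \<rho> (N ^ k) (\<lambda>x. u x ^ k)"
proof (induction k)
  case 0
  then show ?case using polydisc_series_const[OF assms(1), of 1] by simp
next
  case (Suc k)
  then show ?case using polydisc_series_mult[OF assms Suc] by simp
qed

lemma polydisc_series_prod:
  assumes "0 < \<rho>" "finite K" "\<And>k. k \<in> K \<Longrightarrow> polydisc_series \<rho> (N k) (u k)"
  shows "polydisc_series \<rho> (prod N K) (\<lambda>x. \<Prod>k\<in>K. u k x)"
  using assms(2,3)
proof (induction K rule: finite_induct)
  case empty
  then show ?case using polydisc_series_const[OF assms(1), of 1] by simp
next
  case (insert k K)
  have "polydisc_series \<rho> (N k * prod N K) (\<lambda>x. u k x * (\<Prod>k\<in>K. u k x))"
    by (rule polydisc_series_mult[OF assms(1)]) (use insert in auto)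
  then show ?case using insert by simp
qed

lemma polydisc_series_add:
  assumes "0 < \<rho>" "polydisc_series \<rho> N u" "polydisc_series \<rho> L v"
  shows "polydisc_series \<rho> (N + L) (\<lambda>x. u x + v x)"
  \<comment> \<open>A sum of two terms is a finite sum indexed by \<open>bool\<close>.\<close>
  using polydisc_series_sum[of \<rho> "UNIV::bool set" "\<lambda>b. if b then N else L" "\<lambda>b. if b then u else v"] assms
  by (simp add: UNIV_bool add.commute)

text \<open>Submultiplicativity bounds the norm of each substituted monomial by
  \<open>r ^ deg \<alpha>\<close>, where \<open>r\<close> is both the norm of the inner components
  and the radius for \<open>g\<close>. So the norm \<open>N\<close> of \<open>g\<close> survives
  unchanged.\<close>

lemma polydisc_series_compose:
  fixes g :: "real^'n \<Rightarrow> real" and u :: "real^'m \<Rightarrow> real^'n"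
  assumes "0 < \<rho>" "polydisc_series r N g" "\<And>i. polydisc_series \<rho> r (\<lambda>x. u x $ i)"
  shows "polydisc_series \<rho> N (\<lambda>x. g (u x))"
proof -
  obtain c M where c: "M \<le> N" "((\<lambda>\<alpha>. \<bar>c \<alpha>\<bar> * r ^ deg \<alpha>) has_sum M) UNIV"
    "\<And>x. (\<forall>i. \<bar>x $ i\<bar> \<le> r) \<Longrightarrow> ((\<lambda>\<alpha>. c \<alpha> * monomial_at x \<alpha>) has_sum g x) UNIV"
    using assms(2) unfolding polydisc_series_def polydisc_series_with_def by blast
  have "polydisc_series \<rho> (\<bar>c \<alpha>\<bar> * r ^ deg \<alpha>) (\<lambda>x. c \<alpha> * monomial_at (u x) \<alpha>)" for \<alpha>
    unfolding monomial_at_def power_sum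
    by (intro polydisc_series_mult polydisc_series_const polydisc_series_prod polydisc_series_power assms(1,3)) simp
  then show ?thesis
  proof (rule polydisc_series_has_sum[OF assms(1) _ c(2), THEN polydisc_series_mono])
    show "((\<lambda>\<alpha>. c \<alpha> * monomial_at (u x) \<alpha>) has_sum g (u x)) UNIV" if "\<forall>i. \<bar>x $ i\<bar> \<le> \<rho>" for x
      by (rule c(3)) (use polydisc_series_abs_le[OF assms(3)] that in blast)
  qed (rule c(1))
qed

text \<open>A monomial of degree \<open>d\<close> shrinks by \<open>(\<rho>' / \<rho>) ^ d\<close>,
  so vanishing to order \<open>k\<close> gains the \<open>k\<close>-th power. The case
  \<open>k = 0\<close> is plain restriction, \<open>k = 1\<close> makes norms small, and general
  \<open>k\<close> later beats the geometric growth of homogeneous parts.\<close>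

lemma polydisc_series_with_shrink:
  assumes "0 < \<rho>'" "\<rho>' \<le> \<rho>" "polydisc_series_with c \<rho> N u" "\<And>\<alpha>. deg \<alpha> < k \<Longrightarrow> c \<alpha> = 0"
  shows "polydisc_series_with c \<rho>' ((\<rho>' / \<rho>) ^ k * N) u"
proof -
  obtain M where c: "M \<le> N" "((\<lambda>\<alpha>. \<bar>c \<alpha>\<bar> * \<rho> ^ deg \<alpha>) has_sum M) UNIV"
    using assms(3) unfolding polydisc_series_with_def by blast
  have \<rho>: "0 < \<rho>" using assms by linarith
  have le: "\<bar>c \<alpha>\<bar> * \<rho>' ^ deg \<alpha> \<le> (\<rho>' / \<rho>) ^ k * (\<bar>c \<alpha>\<bar> * \<rho> ^ deg \<alpha>)" for \<alpha>
  proof (cases "deg \<alpha> < k")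
    case False
    have "(\<rho>' / \<rho>) ^ deg \<alpha> \<le> (\<rho>' / \<rho>) ^ k"
      using False assms \<rho> by (intro power_decreasing) auto
    then have "\<rho>' ^ deg \<alpha> \<le> (\<rho>' / \<rho>) ^ k * \<rho> ^ deg \<alpha>"
      using \<rho> by (simp add: power_divide divide_le_eq)
    from mult_left_mono[OF this, of "\<bar>c \<alpha>\<bar>"] show ?thesis by (simp add: mult_ac)
  qed (use assms in simp)
  have s: "((\<lambda>\<alpha>. (\<rho>' / \<rho>) ^ k * (\<bar>c \<alpha>\<bar> * \<rho> ^ deg \<alpha>)) has_sum (\<rho>' / \<rho>) ^ k * M) UNIV"
    by (rule has_sum_cmult_right[OF c(2)])
  have "(\<lambda>\<alpha>. \<bar>c \<alpha>\<bar> * \<rho>' ^ deg \<alpha>) summable_on UNIV"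
    by (rule summable_on_comparison_test[OF has_sum_imp_summable[OF s]]) (use le assms(1) in auto)
  then have h: "((\<lambda>\<alpha>. \<bar>c \<alpha>\<bar> * \<rho>' ^ deg \<alpha>) has_sum infsum (\<lambda>\<alpha>. \<bar>c \<alpha>\<bar> * \<rho>' ^ deg \<alpha>) UNIV) UNIV"
    by simp
  moreover have "infsum (\<lambda>\<alpha>. \<bar>c \<alpha>\<bar> * \<rho>' ^ deg \<alpha>) UNIV \<le> (\<rho>' / \<rho>) ^ k * M"
    by (rule has_sum_mono[OF h s le])
  moreover have "(\<rho>' / \<rho>) ^ k * M \<le> (\<rho>' / \<rho>) ^ k * N"
    using c(1) assms \<rho> by (intro mult_left_mono) auto
  ultimately show ?thesis
    using assms(2,3) unfolding polydisc_series_with_def by (meson order_trans)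
qed

lemma polydisc_series_shrink: "0 < \<rho>' \<Longrightarrow> \<rho>' \<le> \<rho> \<Longrightarrow> polydisc_series \<rho> N u \<Longrightarrow> polydisc_series \<rho>' N u"
  using polydisc_series_with_shrink[of \<rho>' \<rho> _ N u 0] by (auto simp: polydisc_series_def)

text \<open>Without constant term the norm decays at least linearly with the radius. This supplies
  the smallness needed for geometric series, for substitution and for continuity.\<close>

lemma polydisc_series_small:
  assumes "0 < \<rho>" "polydisc_series \<rho> N u" "u 0 = 0" "0 < \<epsilon>"
  obtains \<rho>' where "0 < \<rho>'" "\<rho>' \<le> \<rho>" "polydisc_series \<rho>' \<epsilon> u"
proof -
  obtain c where c: "polydisc_series_with c \<rho> N u" using assms by (auto simp: polydisc_series_def)
  have "((\<lambda>\<alpha>. c \<alpha> * monomial_at 0 \<alpha>) has_sum u 0) UNIV"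
    using c assms(1) unfolding polydisc_series_with_def by fastforce
  moreover have "((\<lambda>\<alpha>. c \<alpha> * monomial_at 0 \<alpha>) has_sum c (\<lambda>_. 0)) UNIV"
    by (rule has_sum_finite_neutralI[of "{\<lambda>_. 0}"]) (auto simp: monomial_at_zero)
  ultimately have "c (\<lambda>_. 0) = 0" using assms(3) has_sum_unique by metis
  then have c0: "c \<alpha> = 0" if "deg \<alpha> < 1" for \<alpha>
  proof -
    have "\<alpha> = (\<lambda>_. 0)" using that by (simp add: fun_eq_iff)
    then show ?thesis using \<open>c (\<lambda>_. 0) = 0\<close> by simp
  qed
  have "0 \<le> N" using polydisc_series_nonneg assms by fastforce
  \<comment> \<open>The \<open>+ 1\<close> covers \<open>N = 0\<close>; the new norm is at most
    \<open>\<epsilon> * (N / (N + 1))\<close>.\<close>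
  define \<rho>' where "\<rho>' = min \<rho> (\<rho> * \<epsilon> / (N + 1))"
  have \<rho>': "0 < \<rho>'" "\<rho>' \<le> \<rho>" using assms \<open>0 \<le> N\<close> by (auto simp: \<rho>'_def)
  have "\<rho>' / \<rho> * N \<le> (\<rho> * \<epsilon> / (N + 1)) / \<rho> * N"
    using assms \<open>0 \<le> N\<close> by (intro mult_right_mono divide_right_mono) (auto simp: \<rho>'_def)
  also have "\<dots> = \<epsilon> * (N / (N + 1))" using assms by simp
  also have "\<dots> \<le> \<epsilon>" using assms \<open>0 \<le> N\<close> by (intro mult_left_le) auto
  finally have "(\<rho>' / \<rho>) ^ 1 * N \<le> \<epsilon>" by simp
  moreover have "polydisc_series_with c \<rho>' ((\<rho>' / \<rho>) ^ 1 * N) u"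
    by (rule polydisc_series_with_shrink[OF \<rho>' c]) (rule c0)
  ultimately have "polydisc_series \<rho>' \<epsilon> u" using polydisc_series_with_mono polydisc_series_with_polydisc_series by blast
  then show thesis by (rule that[OF \<rho>'])
qed

subsection \<open>Calculus of real analytic functions\<close>

lemma norm_less_of_components:
  fixes x :: "real^'n"
  assumes "0 < r" "\<forall>i. \<bar>x $ i\<bar> \<le> r / (2 * CARD('n))"
  shows "norm x < r"
proof -
  have "norm x \<le> (\<Sum>i\<in>UNIV. \<bar>x $ i\<bar>)" by (rule norm_le_l1_cart)
  also have "\<dots> \<le> (\<Sum>i\<in>(UNIV::'n set). r / (2 * CARD('n)))" by (rule sum_mono) (use assms in auto)
  also have "\<dots> = r / 2" by simp
  finally show ?thesis using assms by simp
qed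

text \<open>Links the given definition on balls to weighted norms on polydiscs. Unordered
  summability of reals is absolute, so convergence at a corner of a cube inside the ball already
  bounds the weighted norm of the coefficients.\<close>

lemma real_analytic_at_iff:
  fixes f :: "real^'n \<Rightarrow> real"
  shows "real_analytic_at f a \<longleftrightarrow> (\<exists>\<rho>>0. \<exists>N. polydisc_series \<rho> N (\<lambda>x. f (a + x)))"
proof
  assume "real_analytic_at f a"
  then obtain r c where r: "r > 0" and c: "\<And>x. x \<in> ball a r \<Longrightarrow>
      ((\<lambda>\<alpha>. c \<alpha> * (\<Prod>i\<in>UNIV. (x $ i - a $ i) ^ \<alpha> i)) has_sum f x) UNIV"
    unfolding real_analytic_at_def by blast
  define \<rho> where "\<rho> = r / (2 * CARD('n))"
  have \<rho>: "\<rho> > 0" using r by (simp add: \<rho>_def)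
  have hs: "((\<lambda>\<alpha>. c \<alpha> * monomial_at x \<alpha>) has_sum f (a + x)) UNIV" if "\<forall>i. \<bar>x $ i\<bar> \<le> \<rho>" for x
    using c[of "a + x"] norm_less_of_components[OF r, of x] that
    by (simp add: \<rho>_def monomial_at_def dist_norm)
  \<comment> \<open>At the corner with all coordinates \<open>\<rho>\<close> the monomials are
    exactly the weights.\<close>
  have "(\<lambda>\<alpha>. c \<alpha> * monomial_at (\<chi> i. \<rho>) \<alpha>) summable_on UNIV"
    by (rule has_sum_imp_summable[OF hs]) (use \<rho> in simp)
  then have "(\<lambda>\<alpha>. norm (c \<alpha> * monomial_at (\<chi> i. \<rho>) \<alpha>)) summable_on UNIV"
    by (subst (asm) summable_on_iff_abs_summable_on_real)
  then have "(\<lambda>\<alpha>. \<bar>c \<alpha>\<bar> * \<rho> ^ deg \<alpha>) summable_on UNIV"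
    using \<rho> by (simp add: monomial_at_const abs_mult)
  then have "((\<lambda>\<alpha>. \<bar>c \<alpha>\<bar> * \<rho> ^ deg \<alpha>) has_sum (infsum (\<lambda>\<alpha>. \<bar>c \<alpha>\<bar> * \<rho> ^ deg \<alpha>) UNIV)) UNIV"
    by simp
  with hs \<rho> show "\<exists>\<rho>>0. \<exists>N. polydisc_series \<rho> N (\<lambda>x. f (a + x))"
    unfolding polydisc_series_def polydisc_series_with_def by blast
next
  assume "\<exists>\<rho>>0. \<exists>N. polydisc_series \<rho> N (\<lambda>x. f (a + x))"
  then obtain \<rho> c where \<rho>: "\<rho> > 0" and c: "\<And>x. (\<forall>i. \<bar>x $ i\<bar> \<le> \<rho>) \<Longrightarrow>
      ((\<lambda>\<alpha>. c \<alpha> * monomial_at x \<alpha>) has_sum f (a + x)) UNIV"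
    unfolding polydisc_series_def polydisc_series_with_def by blast
  have "((\<lambda>\<alpha>. c \<alpha> * (\<Prod>i\<in>UNIV. (x $ i - a $ i) ^ \<alpha> i)) has_sum f x) UNIV" if "x \<in> ball a \<rho>" for x
  proof -
    have "norm (x - a) < \<rho>" using that by (simp add: dist_norm norm_minus_commute)
    then have "\<forall>i. \<bar>(x - a) $ i\<bar> \<le> \<rho>"
      using component_le_norm_cart[of "x - a"] by (meson less_imp_le order_trans)
    from c[OF this] show ?thesis by (simp add: monomial_at_def)
  qed
  then show "real_analytic_at f a"
    unfolding real_analytic_at_def using \<rho> by blast
qed

lemma real_analytic_at_cong:
  assumes "real_analytic_at f a" "e > 0" "\<And>x. x \<in> ball a e \<Longrightarrow> f x = g x"
  shows "real_analytic_at g a"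
proof -
  obtain r c where "r > 0" and c: "\<And>x. x \<in> ball a r \<Longrightarrow>
      ((\<lambda>\<alpha>. c \<alpha> * (\<Prod>i\<in>UNIV. (x $ i - a $ i) ^ \<alpha> i)) has_sum f x) UNIV"
    using assms(1) unfolding real_analytic_at_def by blast
  have "((\<lambda>\<alpha>. c \<alpha> * (\<Prod>i\<in>UNIV. (x $ i - a $ i) ^ \<alpha> i)) has_sum g x) UNIV" if "x \<in> ball a (min r e)" for x
  proof -
    have x: "x \<in> ball a r" "x \<in> ball a e" using that by auto
    show ?thesis using c[OF x(1)] unfolding assms(3)[OF x(2)] .
  qed
  moreover have "min r e > 0" using \<open>r > 0\<close> assms(2) by simp
  ultimately show ?thesis unfolding real_analytic_at_def by blast
qed

lemma real_analytic_at_cong_open: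
  assumes "real_analytic_at f a" "open U" "a \<in> U" "\<And>x. x \<in> U \<Longrightarrow> f x = g x"
  shows "real_analytic_at g a"
proof -
  obtain e where "e > 0" "ball a e \<subseteq> U" using assms(2,3) open_contains_ball by blast
  then show ?thesis using real_analytic_at_cong[OF assms(1)] assms(4) by blast
qed

lemma polydisc_series_common:
  assumes "real_analytic_at f a" "real_analytic_at g a"
  obtains \<rho> N L where "\<rho> > 0" "polydisc_series \<rho> N (\<lambda>x. f (a + x))" "polydisc_series \<rho> L (\<lambda>x. g (a + x))"
proof -
  obtain \<rho> N \<rho>' L where h: "\<rho> > 0" "polydisc_series \<rho> N (\<lambda>x. f (a + x))" "\<rho>' > 0" "polydisc_series \<rho>' L (\<lambda>x. g (a + x))"
    using assms unfolding real_analytic_at_iff by blast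
  show thesis
    by (rule that[of "min \<rho> \<rho>'" N L])
       (use h in \<open>auto intro: polydisc_series_shrink[OF _ _ h(2)] polydisc_series_shrink[OF _ _ h(4)]\<close>)
qed

lemma real_analytic_at_const: "real_analytic_at (\<lambda>x. k) a"
  unfolding real_analytic_at_iff using polydisc_series_const[of 1 k] zero_less_one by blast

lemma real_analytic_at_component: "real_analytic_at (\<lambda>x. x $ i) a"
proof -
  have "polydisc_series 1 (\<bar>a $ i\<bar> + 1) (\<lambda>x. a $ i + x $ i)"
    by (intro polydisc_series_add polydisc_series_const polydisc_series_component) auto
  then show ?thesis
    unfolding real_analytic_at_iff vector_add_component using zero_less_one by blast
qed

lemma real_analytic_at_add:
  assumes "real_analytic_at f a" "real_analytic_at g a"
  shows "real_analytic_at (\<lambda>x. f x + g x) a"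
  using polydisc_series_common[OF assms] polydisc_series_add unfolding real_analytic_at_iff by metis

lemma real_analytic_at_mult:
  assumes "real_analytic_at f a" "real_analytic_at g a"
  shows "real_analytic_at (\<lambda>x. f x * g x) a"
  using polydisc_series_common[OF assms] polydisc_series_mult unfolding real_analytic_at_iff by metis

lemma real_analytic_at_diff:
  assumes "real_analytic_at f a" "real_analytic_at g a"
  shows "real_analytic_at (\<lambda>x. f x - g x) a"
  using real_analytic_at_add[OF assms(1) real_analytic_at_mult[OF real_analytic_at_const[of "-1"] assms(2)]]
  by simp

lemma real_analytic_at_power:
  assumes "real_analytic_at f a"
  shows "real_analytic_at (\<lambda>x. f x ^ k) a"
  by (induction k) (auto intro: real_analytic_at_const real_analytic_at_mult assms)

lemma real_analytic_at_sum:
  assumes "\<And>i. i \<in> I \<Longrightarrow> real_analytic_at (f i) a"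
  shows "real_analytic_at (\<lambda>x. \<Sum>i\<in>I. f i x) a"
  using assms
  by (induction I rule: infinite_finite_induct) (auto intro: real_analytic_at_const real_analytic_at_add)

lemma polydisc_series_geometric:
  assumes "0 < \<rho>" "polydisc_series \<rho> (1/2) w"
  shows "polydisc_series \<rho> 2 (\<lambda>x. 1 / (1 - w x))"
proof (rule polydisc_series_has_sum[OF assms(1), where K=UNIV and N="\<lambda>k. (1/2)^k" and u="\<lambda>k x. w x ^ k"])
  show "polydisc_series \<rho> ((1/2)^k) (\<lambda>x. w x ^ k)" for k by (rule polydisc_series_power[OF assms])
  have geo: "((\<lambda>k. q ^ k) has_sum 1 / (1 - q)) UNIV" if "\<bar>q\<bar> \<le> 1/2" for q :: real
  proof (rule norm_summable_imp_has_sum)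
    show "summable (\<lambda>k. norm (q ^ k))" using that by (simp add: power_abs summable_geometric)
    show "(\<lambda>k. q ^ k) sums (1 / (1 - q))" using that by (intro geometric_sums) simp
  qed
  show "((\<lambda>k. (1/2::real)^k) has_sum 2) UNIV" using geo[of "1/2"] by simp
  show "((\<lambda>k. w x ^ k) has_sum 1 / (1 - w x)) UNIV" if "\<forall>i. \<bar>x $ i\<bar> \<le> \<rho>" for x
    by (rule geo) (rule polydisc_series_abs_le[OF assms(2) that])
qed

lemma real_analytic_at_inverse:
  assumes "real_analytic_at f a" "f a \<noteq> 0"
  shows "real_analytic_at (\<lambda>x. inverse (f x)) a"
proof -
  obtain \<rho> N where \<rho>: "\<rho> > 0" and f: "polydisc_series \<rho> N (\<lambda>x. f (a + x))"
    using assms unfolding real_analytic_at_iff by blast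
  \<comment> \<open>Chosen so that \<open>f (a + x) = f a * (1 - w x)\<close> with
    \<open>w 0 = 0\<close>; the reciprocal is then a geometric series once \<open>w\<close> has norm
    at most 1/2.\<close>
  define w where "w x = 1 + (- 1 / f a) * f (a + x)" for x
  have "polydisc_series \<rho> (\<bar>1\<bar> + \<bar>- 1 / f a\<bar> * N) w"
    unfolding w_def by (intro polydisc_series_add polydisc_series_mult polydisc_series_const \<rho> f)
  moreover have "w 0 = 0" using assms by (simp add: w_def)
  ultimately obtain \<rho>' where \<rho>': "\<rho>' > 0" and w: "polydisc_series \<rho>' (1/2) w"
    using polydisc_series_small[OF \<rho>, of "\<bar>1\<bar> + \<bar>- 1 / f a\<bar> * N" w "1/2"] by auto
  have "polydisc_series \<rho>' (\<bar>1 / f a\<bar> * 2) (\<lambda>x. 1 / f a * (1 / (1 - w x)))"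
    by (intro polydisc_series_mult polydisc_series_const \<rho>' polydisc_series_geometric w)
  moreover have "1 / f a * (1 / (1 - w x)) = inverse (f (a + x))" for x
    using assms by (simp add: w_def field_simps)
  ultimately show ?thesis unfolding real_analytic_at_iff using \<rho>' by auto
qed

lemma real_analytic_at_divide:
  assumes "real_analytic_at f a" "real_analytic_at g a" "g a \<noteq> 0"
  shows "real_analytic_at (\<lambda>x. f x / g x) a"
  unfolding divide_inverse
  by (intro real_analytic_at_mult real_analytic_at_inverse assms)

lemma real_analytic_at_compose:
  fixes f :: "real^'n \<Rightarrow> real" and \<phi> :: "real^'m \<Rightarrow> real^'n"
  assumes "real_analytic_at f (\<phi> a)" "\<And>i. real_analytic_at (\<lambda>x. \<phi> x $ i) a"
  shows "real_analytic_at (\<lambda>x. f (\<phi> x)) a"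
proof -
  obtain r N where r: "r > 0" and f: "polydisc_series r N (\<lambda>x. f (\<phi> a + x))"
    using assms unfolding real_analytic_at_iff by blast
  \<comment> \<open>The increment of \<open>\<phi>\<close> vanishes at 0, so on a small polydisc
    each component has norm at most the radius \<open>r\<close> on which \<open>f\<close> has its
    expansion.\<close>
  define u where "u x = \<phi> (a + x) - \<phi> a" for x
  have "\<exists>\<rho>>0. polydisc_series \<rho> r (\<lambda>x. u x $ i)" for i
  proof -
    obtain \<rho> M where \<rho>: "\<rho> > 0" and "polydisc_series \<rho> M (\<lambda>x. \<phi> (a + x) $ i)"
      using assms(2)[of i] unfolding real_analytic_at_iff by blast
    then have "polydisc_series \<rho> (M + \<bar>- \<phi> a $ i\<bar>) (\<lambda>x. \<phi> (a + x) $ i + - \<phi> a $ i)"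
      by (intro polydisc_series_add polydisc_series_const)
    then have "polydisc_series \<rho> (M + \<bar>- \<phi> a $ i\<bar>) (\<lambda>x. u x $ i)" by (simp add: u_def)
    moreover have "u 0 $ i = 0" by (simp add: u_def)
    ultimately show ?thesis using polydisc_series_small[OF \<rho> _ _ r, of _ "\<lambda>x. u x $ i"] by blast
  qed
  then obtain \<rho> where \<rho>: "\<And>i. \<rho> i > 0" "\<And>i. polydisc_series (\<rho> i) r (\<lambda>x. u x $ i)" by metis
  define \<rho>' where "\<rho>' = Min (range \<rho>)"
  have "\<rho>' > 0" "\<And>i. \<rho>' \<le> \<rho> i" using \<rho>(1) by (auto simp: \<rho>'_def)
  then have "polydisc_series \<rho>' N (\<lambda>x. f (\<phi> a + u x))"
    by (intro polydisc_series_compose[OF _ f] polydisc_series_shrink[OF _ _ \<rho>(2)])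
  then show ?thesis
    unfolding real_analytic_at_iff using \<open>\<rho>' > 0\<close> by (auto simp: u_def)
qed

text \<open>Re-expansion at another centre is substitution of the translation
  \<open>x \<mapsto> b + x\<close>, whose components have norm at most \<open>\<rho>\<close> on the
  polydisc of radius \<open>\<rho>\<close> minus the largest
  \<open>\<bar>b $ i\<bar>\<close>.\<close>

lemma polydisc_series_real_analytic_at:
  fixes f :: "real^'n \<Rightarrow> real"
  assumes "\<rho> > 0" "polydisc_series \<rho> N f" "\<And>i. \<bar>b $ i\<bar> < \<rho>"
  shows "real_analytic_at f b"
proof -
  define m where "m = Max (range (\<lambda>i. \<bar>b $ i\<bar>))"
  have m: "\<bar>b $ i\<bar> \<le> m" for i by (simp add: m_def)
  have "m < \<rho>" using assms(3) by (simp add: m_def)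
  define \<rho>' where "\<rho>' = \<rho> - m"
  have \<rho>': "\<rho>' > 0" using \<open>m < \<rho>\<close> by (simp add: \<rho>'_def)
  have "polydisc_series \<rho>' \<rho> (\<lambda>x. (b + x) $ i)" for i
  proof -
    have "polydisc_series \<rho>' (\<bar>b $ i\<bar> + \<rho>') (\<lambda>x. b $ i + x $ i)"
      by (intro polydisc_series_add polydisc_series_const polydisc_series_component \<rho>')
    then show ?thesis using m[of i] by (auto simp: \<rho>'_def intro: polydisc_series_mono)
  qed
  then have "polydisc_series \<rho>' N (\<lambda>x. f (b + x))" by (rule polydisc_series_compose[OF \<rho>' assms(2)])
  then show ?thesis unfolding real_analytic_at_iff using \<rho>' by blast
qed

lemma real_analytic_at_nearby:
  fixes f :: "real^'n \<Rightarrow> real"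
  assumes "real_analytic_at f a"
  obtains r where "r > 0" "\<And>b. b \<in> ball a r \<Longrightarrow> real_analytic_at f b"
proof -
  obtain \<rho> N where \<rho>: "\<rho> > 0" and f: "polydisc_series \<rho> N (\<lambda>x. f (a + x))"
    using assms unfolding real_analytic_at_iff by blast
  have "real_analytic_at f b" if "b \<in> ball a \<rho>" for b
  proof -
    have "\<bar>(b - a) $ i\<bar> < \<rho>" for i
      using that component_le_norm_cart[of "b - a" i] by (simp add: dist_norm norm_minus_commute)
    then have 1: "real_analytic_at (\<lambda>x. f (a + x)) (b - a)"
      by (rule polydisc_series_real_analytic_at[OF \<rho> f])
    have "real_analytic_at (\<lambda>x. (\<lambda>z. f (a + z)) (x - a)) b"
      by (rule real_analytic_at_compose[where f="\<lambda>z. f (a + z)" and \<phi>="\<lambda>x. x - a", OF 1])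
         (auto intro!: real_analytic_at_diff real_analytic_at_component real_analytic_at_const)
    then show ?thesis by simp
  qed
  then show thesis using that \<rho> by blast
qed

lemma real_analytic_at_isCont:
  fixes f :: "real^'n \<Rightarrow> real"
  assumes "real_analytic_at f a"
  shows "isCont f a"
  unfolding continuous_at_eps_delta
proof (intro allI impI)
  fix e :: real assume "0 < e"
  obtain \<rho> N where \<rho>: "\<rho> > 0" and f: "polydisc_series \<rho> N (\<lambda>x. f (a + x))"
    using assms unfolding real_analytic_at_iff by blast
  have "polydisc_series \<rho> (N + \<bar>- f a\<bar>) (\<lambda>x. f (a + x) + - f a)"
    by (intro polydisc_series_add polydisc_series_const \<rho> f)
  from polydisc_series_small[OF \<rho> this, of "e/2"] \<open>0 < e\<close>
  obtain \<rho>' where \<rho>': "\<rho>' > 0" "polydisc_series \<rho>' (e/2) (\<lambda>x. f (a + x) + - f a)" by auto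
  have "dist (f x) (f a) < e" if "dist x a < \<rho>'" for x
  proof -
    have "norm (x - a) < \<rho>'" using that by (simp add: dist_norm)
    then have "\<forall>i. \<bar>(x - a) $ i\<bar> \<le> \<rho>'"
      using component_le_norm_cart[of "x - a"] by (meson less_imp_le order_trans)
    from polydisc_series_abs_le[OF \<rho>'(2) this] show ?thesis using \<open>0 < e\<close> by (simp add: dist_real_def)
  qed
  then show "\<exists>d>0. \<forall>x'. dist x' a < d \<longrightarrow> dist (f x') (f a) < e" using \<rho>'(1) by blast
qed

lemmas real_analytic_at_intros = real_analytic_at_const real_analytic_at_component real_analytic_at_add
  real_analytic_at_mult real_analytic_at_diff real_analytic_at_power real_analytic_at_sum

subsection \<open>Restriction to lines and the identity theorem\<close>

definition homogeneous_part :: "(('n::finite \<Rightarrow> nat) \<Rightarrow> real) \<Rightarrow> nat \<Rightarrow> real^'n \<Rightarrow> real" where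
  "homogeneous_part c k w = (\<Sum>\<alpha> | deg \<alpha> = k. c \<alpha> * monomial_at w \<alpha>)"

lemma finite_deg: "finite {\<alpha> :: 'n::finite \<Rightarrow> nat. deg \<alpha> = k}"
proof (rule finite_subset)
  show "{\<alpha> :: 'n::finite \<Rightarrow> nat. deg \<alpha> = k} \<subseteq> UNIV \<rightarrow>\<^sub>E {..k}"
    by (auto intro: member_le_sum)
qed (auto intro: finite_PiE)

lemma homogeneous_part_scale: "homogeneous_part c k (t *\<^sub>R w) = t ^ k * homogeneous_part c k w"
  unfolding homogeneous_part_def sum_distrib_left by (rule sum.cong) (auto simp: monomial_at_scale)

text \<open>Absolute convergence permits grouping by degree. On a line through the centre the series
  becomes a power series in one variable whose coefficients are the homogeneous parts at the
  direction vector.\<close>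

lemma polydisc_series_with_homogeneous_part_sums:
  fixes u :: "real^'n \<Rightarrow> real"
  assumes "polydisc_series_with c \<rho> N u" "\<forall>i. \<bar>t * w $ i\<bar> \<le> \<rho>"
  shows "(\<lambda>k. homogeneous_part c k w * t ^ k) sums u (t *\<^sub>R w)"
proof -
  let ?h = "\<lambda>\<alpha>. c \<alpha> * monomial_at (t *\<^sub>R w) \<alpha>"
  have "(?h has_sum u (t *\<^sub>R w)) UNIV"
    using assms unfolding polydisc_series_with_def by auto
  moreover have "bij_betw snd (SIGMA k:UNIV. {\<alpha> :: 'n \<Rightarrow> nat. deg \<alpha> = k}) UNIV"
    by (rule bij_betwI[where g="\<lambda>\<alpha>. (deg \<alpha>, \<alpha>)"]) auto
  ultimately have "((\<lambda>p. ?h (snd p)) has_sum u (t *\<^sub>R w)) (SIGMA k:UNIV. {\<alpha> :: 'n \<Rightarrow> nat. deg \<alpha> = k})"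
    by (subst has_sum_reindex_bij_betw[where f="?h" and g=snd])
  then have "((\<lambda>k. homogeneous_part c k (t *\<^sub>R w)) has_sum u (t *\<^sub>R w)) UNIV"
    by (rule has_sum_SigmaD) (auto simp: homogeneous_part_def finite_deg intro!: has_sum_finite)
  then show ?thesis by (auto dest!: has_sum_imp_sums simp: homogeneous_part_scale mult.commute)
qed

text \<open>One-variable analyticity is expressed through \<open>real^1\<close>, so that the
  multivariate calculus above applies to curves and lines without a second theory.\<close>

definition analytic1 :: "(real \<Rightarrow> real) \<Rightarrow> real \<Rightarrow> bool" where
  "analytic1 \<phi> t \<longleftrightarrow> real_analytic_at (\<lambda>x::real^1. \<phi> (x $ 1)) (vec t)"

lemma analytic1_series:
  assumes "analytic1 \<phi> t"
  obtains r c where "r > 0" "\<And>h. \<bar>h\<bar> < r \<Longrightarrow> (\<lambda>k. c k * h ^ k) sums \<phi> (t + h)"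
proof -
  obtain \<rho> N c where \<rho>: "\<rho> > 0" and c: "polydisc_series_with c \<rho> N (\<lambda>x::real^1. \<phi> ((vec t + x) $ 1))"
    using assms unfolding analytic1_def real_analytic_at_iff polydisc_series_def by blast
  have "(\<lambda>k. homogeneous_part c k (vec 1) * h ^ k) sums \<phi> (t + h)" if "\<bar>h\<bar> < \<rho>" for h
    using polydisc_series_with_homogeneous_part_sums[OF c, of h "vec 1"] that by simp
  then show thesis by (rule that[OF \<rho>])
qed

lemma analytic1_curve:
  fixes f :: "real^'n \<Rightarrow> real"
  assumes "real_analytic_at f (\<gamma> t)" "\<And>i. analytic1 (\<lambda>s. \<gamma> s $ i) t"
  shows "analytic1 (\<lambda>s. f (\<gamma> s)) t"
  using real_analytic_at_compose[of f "\<lambda>x::real^1. \<gamma> (x $ 1)" "vec t"] assms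
  unfolding analytic1_def by simp

lemma analytic1_line:
  fixes f :: "real^'n \<Rightarrow> real"
  assumes "real_analytic_at f (a + t *\<^sub>R v)"
  shows "analytic1 (\<lambda>s. f (a + s *\<^sub>R v)) t"
  using assms
  by (rule analytic1_curve) (auto simp: analytic1_def intro!: real_analytic_at_intros)

lemma analytic1_diff: "analytic1 f t \<Longrightarrow> analytic1 g t \<Longrightarrow> analytic1 (\<lambda>s. f s - g s) t"
  unfolding analytic1_def by (rule real_analytic_at_diff)

lemma analytic1_isCont:
  assumes "analytic1 \<phi> t"
  shows "isCont \<phi> t"
proof -
  have "isCont (\<lambda>x::real^1. \<phi> (x $ 1)) (vec t)"
    using assms real_analytic_at_isCont unfolding analytic1_def by blast
  then have "isCont (\<lambda>s. \<phi> ((vec s :: real^1) $ 1)) t"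
  proof (rule isCont_o2[where g="\<lambda>x::real^1. \<phi> (x $ 1)" and f=vec, rotated])
    show "isCont (vec :: real \<Rightarrow> real^1) t"
      unfolding isCont_def by (rule vec_tendstoI) simp
  qed
  then show ?thesis by simp
qed

section \<open>Uniqueness of coefficients and the identity theorem in one variable\<close>

lemma powser_coeffs_zero:
  fixes a :: "nat \<Rightarrow> real"
  assumes "r > 0" "\<And>h. \<bar>h\<bar> < r \<Longrightarrow> (\<lambda>k. a k * h ^ k) sums 0"
  shows "a k = 0"
proof (rule ccontr)
  assume k: "a k \<noteq> 0"
  have "(\<lambda>k. a k * 0 ^ k) sums a 0" by (rule powser_sums_zero)
  then have "a 0 = 0" using assms(2)[of 0] assms(1) sums_unique2 by fastforce
  with k have "k > 0" by (metis gr0I)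
  have a: "(\<lambda>n. a n * (x - 0) ^ n) sums 0" if "norm (x - 0) < r" for x
    using assms(2)[of x] that by simp
  \<comment> \<open>A nonzero coefficient would isolate the zero at 0, which is absurd for the zero
    function.\<close>
  obtain s where s: "s > 0" "\<And>z::real. z \<in> cball 0 s - {0} \<Longrightarrow> (0::real) \<noteq> 0"
    using powser_0_nonzero[of r 0 a "\<lambda>_. 0", OF assms(1) a refl k \<open>k > 0\<close>] by metis
  from s(2)[of s] s(1) show False by simp
qed

lemma powser_coeffs_unique:
  fixes a b :: "nat \<Rightarrow> real"
  assumes "r > 0" "\<And>h. \<bar>h\<bar> < r \<Longrightarrow> (\<lambda>k. a k * h ^ k) sums \<phi> h"
    "s > 0" "\<And>h. \<bar>h\<bar> < s \<Longrightarrow> (\<lambda>k. b k * h ^ k) sums \<phi> h"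
  shows "a k = b k"
proof -
  have "(\<lambda>k. (a k - b k) * h ^ k) sums 0" if "\<bar>h\<bar> < min r s" for h
    using sums_diff[OF assms(2,4), of h h] that by (simp add: left_diff_distrib)
  from powser_coeffs_zero[of "min r s" "\<lambda>k. a k - b k", OF _ this] show ?thesis using assms(1,3) by simp
qed

text \<open>Either all Taylor coefficients at \<open>t\<close> vanish, or some nonzero one isolates
  a zero at \<open>t\<close>; if \<open>\<phi> t \<noteq> 0\<close>, continuity suffices.\<close>

lemma analytic1_zero_or_isolated:
  assumes "analytic1 \<phi> t"
  shows "(\<forall>\<^sub>F s in nhds t. \<phi> s = 0) \<or> (\<forall>\<^sub>F s in at t. \<phi> s \<noteq> 0)"
proof (cases "\<phi> t = 0")
  case False
  then show ?thesis
    using analytic1_isCont[OF assms] unfolding isCont_def by (metis tendsto_imp_eventually_ne)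
next
  case True
  obtain r c where r: "r > 0" and c: "\<And>h. \<bar>h\<bar> < r \<Longrightarrow> (\<lambda>k. c k * h ^ k) sums \<phi> (t + h)"
    using analytic1_series[OF assms] by blast
  have c0: "c 0 = 0"
    using sums_unique2[OF powser_sums_zero c[of 0]] r True by simp
  show ?thesis
  proof (cases "\<forall>m>0. c m = 0")
    case True
    with c0 have "c = (\<lambda>_. 0)" by (metis ext gr0I)
    then have "\<phi> (t + h) = 0" if "\<bar>h\<bar> < r" for h
      using c[OF that] by (simp add: sums_iff)
    then have "\<phi> s = 0" if "dist s t < r" for s
      using that by (metis add.commute diff_add_cancel dist_real_def)
    then show ?thesis using r by (auto simp: eventually_nhds_metric)
  next
    case False
    then obtain m where m: "m > 0" "c m \<noteq> 0" by blast
    have c': "(\<lambda>k. c k * (x - t) ^ k) sums \<phi> x" if "norm (x - t) < r" for x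
      using c[of "x - t"] that by simp
    obtain s where s: "s > 0" "\<And>z. z \<in> cball t s - {t} \<Longrightarrow> \<phi> z \<noteq> 0"
      using powser_0_nonzero[OF r c' \<open>\<phi> t = 0\<close> m(2,1)] by metis
    have "\<phi> z \<noteq> 0" if "z \<noteq> t" "dist z t < s" for z
      using s(2)[of z] that by (simp add: dist_commute)
    then show ?thesis using s(1) by (auto simp: eventually_at)
  qed
qed

text \<open>The set \<open>A\<close> of points near which the function vanishes is open, and by the
  dichotomy every point of \<open>S\<close> outside \<open>A\<close> has a neighbourhood disjoint
  from \<open>A\<close>. Connectedness leaves only one of the two pieces.\<close>

lemma analytic1_identity:
  assumes S: "connected S" and an: "\<And>t. t \<in> S \<Longrightarrow> analytic1 \<phi> t"
    and t0: "t0 \<in> S" "\<forall>\<^sub>F s in nhds t0. \<phi> s = 0" and "t \<in> S"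
  shows "\<forall>\<^sub>F s in nhds t. \<phi> s = 0"
proof -
  define A where "A = {t. \<forall>\<^sub>F s in nhds t. \<phi> s = 0}"
  have "open A"
  proof (rule Topological_Spaces.openI)
    fix t assume "t \<in> A"
    then obtain U where "open U" "t \<in> U" "\<forall>s\<in>U. \<phi> s = 0"
      unfolding A_def eventually_nhds by auto
    then show "\<exists>T. open T \<and> t \<in> T \<and> T \<subseteq> A" unfolding A_def eventually_nhds by blast
  qed
  have sep: "\<exists>U. open U \<and> t \<in> U \<and> U \<inter> A = {}" if "t \<in> S" "t \<notin> A" for t
  proof -
    have "\<forall>\<^sub>F s in at t. \<phi> s \<noteq> 0"
      using analytic1_zero_or_isolated[OF an[OF that(1)]] that(2) by (auto simp: A_def)
    then obtain U where U: "open U" "t \<in> U" "\<And>s. s \<in> U \<Longrightarrow> s \<noteq> t \<Longrightarrow> \<phi> s \<noteq> 0"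
      unfolding eventually_at_topological by blast
    have "U \<inter> A = {}"
    proof (rule ccontr)
      assume "U \<inter> A \<noteq> {}"
      then obtain s where s: "s \<in> U" "s \<in> A" by auto
      then have "\<phi> s = 0" unfolding A_def mem_Collect_eq by (blast dest: eventually_nhds_x_imp_x)
      then have "s = t" using U(3) s(1) by blast
      then show False using s(2) that(2) by simp
    qed
    then show ?thesis using U by blast
  qed
  from sep have "\<forall>t. \<exists>U. t \<in> S - A \<longrightarrow> open U \<and> t \<in> U \<and> U \<inter> A = {}" by auto
  then obtain U where U: "\<And>t. t \<in> S - A \<Longrightarrow> open (U t) \<and> t \<in> U t \<and> U t \<inter> A = {}"
    by metis
  have "open (\<Union>t\<in>S - A. U t)" using U by blast
  moreover have "A \<inter> (\<Union>t\<in>S - A. U t) \<inter> S = {}" using U by blast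
  moreover have "S \<subseteq> A \<union> (\<Union>t\<in>S - A. U t)" using U by blast
  ultimately have "A \<inter> S = {} \<or> (\<Union>t\<in>S - A. U t) \<inter> S = {}"
    using connectedD[OF S \<open>open A\<close>] by blast
  moreover have "t0 \<in> A" using t0 by (simp add: A_def)
  ultimately have "(\<Union>t\<in>S - A. U t) \<inter> S = {}" using t0(1) by blast
  then have "t \<in> A" using U \<open>t \<in> S\<close> by blast
  then show ?thesis by (simp add: A_def)
qed

lemma analytic1_identity_eq:
  assumes "connected S" "\<And>t. t \<in> S \<Longrightarrow> analytic1 \<phi> t" "\<And>t. t \<in> S \<Longrightarrow> analytic1 \<psi> t"
    and "t0 \<in> S" "\<forall>\<^sub>F s in nhds t0. \<phi> s = \<psi> s" "t \<in> S"
  shows "\<forall>\<^sub>F s in nhds t. \<phi> s = \<psi> s"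
  using analytic1_identity[of S "\<lambda>s. \<phi> s - \<psi> s" t0 t] assms by (simp add: analytic1_diff)

text \<open>The form in which the identity theorem is used in space: equality near the starting
  point \<open>q\<close> travels to the end of the segment, and analyticity is asked only along the
  segment.\<close>

lemma segment_identity:
  fixes f g :: "real^'n \<Rightarrow> real"
  assumes "\<And>t. t \<in> {0..1} \<Longrightarrow> analytic1 (\<lambda>t. f (q + t *\<^sub>R d)) t"
    and "\<And>t. t \<in> {0..1} \<Longrightarrow> analytic1 (\<lambda>t. g (q + t *\<^sub>R d)) t"
    and "open U" "q \<in> U" "\<And>x. x \<in> U \<Longrightarrow> f x = g x"
  shows "f (q + d) = g (q + d)"
proof -
  have "((\<lambda>s. q + s *\<^sub>R d) \<longlongrightarrow> q + 0 *\<^sub>R d) (nhds 0)"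
    by (intro tendsto_intros filterlim_ident)
  then have "\<forall>\<^sub>F s in nhds 0. q + s *\<^sub>R d \<in> U"
    by (rule topological_tendstoD) (use assms in auto)
  then have "\<forall>\<^sub>F s in nhds 0. f (q + s *\<^sub>R d) = g (q + s *\<^sub>R d)"
    by eventually_elim (rule assms(5))
  then have "\<forall>\<^sub>F s in nhds 1. f (q + s *\<^sub>R d) = g (q + s *\<^sub>R d)"
    using analytic1_identity_eq[of "{0..1}", OF _ assms(1,2), of 0 1] by simp
  from eventually_nhds_x_imp_x[OF this] show ?thesis by simp
qed

subsection \<open>Separately polynomial functions\<close>

definition lagrange :: "(nat \<Rightarrow> real) \<Rightarrow> nat \<Rightarrow> nat \<Rightarrow> real \<Rightarrow> real" where
  "lagrange \<theta> k j s = (\<Prod>l\<in>{..k} - {j}. (s - \<theta> l) / (\<theta> j - \<theta> l))"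

lemma lagrange_interpolation:
  assumes "degree P \<le> k" "inj_on \<theta> {..k}"
  shows "poly P s = (\<Sum>j\<le>k. poly P (\<theta> j) * lagrange \<theta> k j s)"
proof -
  define L where "L j = (\<Prod>l\<in>{..k} - {j}. smult (1 / (\<theta> j - \<theta> l)) [:- \<theta> l, 1:])" for j
  have L: "poly (L j) s = lagrange \<theta> k j s" for j s
    by (simp add: L_def poly_prod lagrange_def diff_divide_distrib)
  define Q where "Q = (\<Sum>j\<le>k. smult (poly P (\<theta> j)) (L j))"
  have "degree (L j) \<le> k" if "j \<le> k" for j
  proof -
    have "degree (L j) \<le> sum (degree \<circ> (\<lambda>l. smult (1 / (\<theta> j - \<theta> l)) [:- \<theta> l, 1:])) ({..k} - {j})"
      unfolding L_def by (rule degree_prod_sum_le) simp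
    also have "\<dots> \<le> (\<Sum>l\<in>{..k} - {j}. 1)" by (rule sum_mono) simp
    also have "\<dots> = k" using that by simp
    finally show ?thesis .
  qed
  then have degQ: "degree Q \<le> k"
    unfolding Q_def by (intro degree_sum_le) (auto intro: order_trans[OF degree_smult_le])
  have delta: "lagrange \<theta> k j (\<theta> i) = (if j = i then 1 else 0)" if "i \<le> k" "j \<le> k" for i j
  proof (cases "j = i")
    case True
    then have "\<theta> i - \<theta> l \<noteq> 0" if "l \<in> {..k} - {i}" for l
      using that \<open>i \<le> k\<close> assms(2) by (auto dest: inj_onD)
    then show ?thesis using True by (simp add: lagrange_def)
  next
    case False
    then show ?thesis using that by (auto simp: lagrange_def)
  qed
  have "P = Q"
  proof (rule poly_eqI_degree[of "\<theta> ` {..k}"])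
    show "poly P x = poly Q x" if x: "x \<in> \<theta> ` {..k}" for x
    proof -
      obtain i where i: "x = \<theta> i" "i \<le> k" using x by auto
      have "poly Q x = (\<Sum>j\<le>k. if j = i then poly P (\<theta> j) else 0)"
        unfolding Q_def poly_sum i(1) by (rule sum.cong) (use delta i in \<open>auto simp: L\<close>)
      then show ?thesis using i by simp
    qed
  qed (use assms degQ in \<open>auto simp: card_image\<close>)
  then have "poly P s = poly Q s" by simp
  then show ?thesis by (simp add: Q_def poly_sum L)
qed

text \<open>Equally spaced nodes for \<open>j = 0, ..., k\<close>. The denominator
  \<open>k + 1\<close> keeps the last node strictly below \<open>\<eta>\<close> and also makes sense
  for \<open>k = 0\<close>.\<close>

definition nodes :: "real \<Rightarrow> nat \<Rightarrow> nat \<Rightarrow> real" where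
  "nodes \<eta> k j = \<eta> * j / (k + 1)"

lemma nodes_diff: "nodes \<eta> k j - nodes \<eta> k l = \<eta> / (k + 1) * (real j - real l)"
  by (simp add: nodes_def right_diff_distrib diff_divide_distrib)

lemma nodes_inj: "\<eta> > 0 \<Longrightarrow> inj_on (nodes \<eta> k) A"
  by (auto simp: inj_on_def nodes_def)

lemma nodes_bound: "\<eta> > 0 \<Longrightarrow> j \<le> k \<Longrightarrow> \<bar>nodes \<eta> k j\<bar> < \<eta>"
  by (simp add: nodes_def abs_mult divide_less_eq)

text \<open>Up to scaling, this is the denominator of a Lagrange basis polynomial at equally spaced
  nodes.\<close>

lemma prod_abs_diff:
  assumes "j \<le> k"
  shows "(\<Prod>l\<in>{..k} - {j}. \<bar>real j - real l\<bar>) = fact j * fact (k - j)"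
  using assms
proof (induction k rule: dec_induct)
  case base
  have "{..j} - {j} = {0..<j}" by auto
  moreover have "(\<Prod>l\<in>{0..<j}. \<bar>real j - real l\<bar>) = (\<Prod>l\<in>{0..<j}. real (j - l))"
    by (rule prod.cong) (auto simp: of_nat_diff)
  ultimately show ?case by (simp add: fact_prod_rev)
next
  case (step k)
  have "{..Suc k} - {j} = insert (Suc k) ({..k} - {j})" using step by auto
  moreover have "\<bar>real j - real (Suc k)\<bar> = real (Suc k - j)" using step by simp
  moreover have "fact (Suc k - j) = real (Suc k - j) * fact (k - j)"
    using step by (simp add: Suc_diff_le)
  ultimately show ?case using step by simp
qed

text \<open>A single term of the exponential series is at most the whole. This weak form of
  Stirling's bound turns \<open>(k + 1) ^ k\<close> into a factorial times a geometric
  factor.\<close>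

lemma power_le_exp_fact:
  fixes x :: real
  assumes "0 \<le> x"
  shows "x ^ n \<le> exp x * fact n"
proof -
  have "(\<Sum>k\<in>{n}. x ^ k /\<^sub>R fact k) \<le> exp x"
    unfolding exp_def by (rule sum_le_suminf) (use assms summable_exp_generic[of x] in auto)
  then show ?thesis by (simp add: field_simps)
qed

text \<open>What matters is that the norm grows only geometrically in \<open>k\<close>. Each
  numerator has norm at most \<open>R\<close>; the denominators give \<open>j! (k - j)!\<close>
  times \<open>(\<eta> / (k + 1)) ^ k\<close>, and the factorials cancel up to \<open>2 ^ k\<close>
  and powers of \<open>e\<close>.\<close>

lemma polydisc_series_lagrange:
  fixes v :: "real^'n"
  assumes "\<rho> > 0" "\<eta> > 0" "j \<le> k" and R: "\<And>i. \<rho> + \<bar>v $ i\<bar> + \<eta> \<le> R"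
  shows "polydisc_series \<rho> (exp 1 * (2 * exp 1 * R / \<eta>) ^ k) (\<lambda>x. lagrange (nodes \<eta> k) k j (x $ i - v $ i))"
proof -
  let ?\<theta> = "nodes \<eta> k"
  have R0: "R > 0" using R[of undefined] assms by linarith
  have "polydisc_series \<rho> (R * (1 / \<bar>?\<theta> j - ?\<theta> l\<bar>)) (\<lambda>x. (x $ i - v $ i - ?\<theta> l) / (?\<theta> j - ?\<theta> l))"
    if "l \<le> k" for l
  proof -
    have "polydisc_series \<rho> (\<rho> + \<bar>- v $ i - ?\<theta> l\<bar>) (\<lambda>x. x $ i + (- v $ i - ?\<theta> l))"
      by (intro polydisc_series_add polydisc_series_component polydisc_series_const assms)
    then have "polydisc_series \<rho> R (\<lambda>x. x $ i - v $ i - ?\<theta> l)"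
      using R[of i] nodes_bound[OF assms(2) that] by (auto intro: polydisc_series_mono simp: algebra_simps)
    then have "polydisc_series \<rho> (R * \<bar>1 / (?\<theta> j - ?\<theta> l)\<bar>) (\<lambda>x. (x $ i - v $ i - ?\<theta> l) * (1 / (?\<theta> j - ?\<theta> l)))"
      by (intro polydisc_series_mult polydisc_series_const assms)
    then show ?thesis by simp
  qed
  then have "polydisc_series \<rho> (\<Prod>l\<in>{..k} - {j}. R * (1 / \<bar>?\<theta> j - ?\<theta> l\<bar>)) (\<lambda>x. lagrange ?\<theta> k j (x $ i - v $ i))"
    unfolding lagrange_def by (intro polydisc_series_prod assms) auto
  moreover have "(\<Prod>l\<in>{..k} - {j}. R * (1 / \<bar>?\<theta> j - ?\<theta> l\<bar>)) \<le> exp 1 * (2 * exp 1 * R / \<eta>) ^ k"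
  proof -
    have fact: "fact k \<le> 2 ^ k * (fact j * fact (k - j) :: real)"
    proof -
      have "fact j * fact (k - j) * (k choose j) = fact k" by (rule binomial_fact_lemma[OF assms(3)])
      then have "fact k = (fact j * fact (k - j)) * real (k choose j)"
        by (metis of_nat_fact of_nat_mult)
      also have "\<dots> \<le> (fact j * fact (k - j)) * 2 ^ k"
        using binomial_le_pow2[of k j] by (intro mult_left_mono) (auto simp: of_nat_le_iff[symmetric] simp del: of_nat_le_iff)
      finally show ?thesis by (simp add: mult.commute)
    qed
    \<comment> \<open>The bound is taken at exponent \<open>k + 1\<close>, so that a factor
      \<open>k + 1\<close> cancels and \<open>fact k\<close> remains.\<close>
    have "real (k + 1) ^ k * real (k + 1) \<le> exp (real (k + 1)) * (fact k * real (k + 1))"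
      using power_le_exp_fact[of "real (k + 1)" "k + 1"] by (simp add: mult_ac)
    then have kk: "real (k + 1) ^ k \<le> exp (real (k + 1)) * fact k"
      by simp
    have "(\<Prod>l\<in>{..k} - {j}. R * (1 / \<bar>?\<theta> j - ?\<theta> l\<bar>))
        = (\<Prod>l\<in>{..k} - {j}. R * real (k + 1) / \<eta>) / (\<Prod>l\<in>{..k} - {j}. \<bar>real j - real l\<bar>)"
      unfolding prod_dividef[symmetric] using assms(2)
      by (intro prod.cong) (auto simp: nodes_diff abs_mult)
    also have "\<dots> = (R / \<eta>) ^ k * real (k + 1) ^ k / (fact j * fact (k - j))"
      using assms(3) by (simp add: prod_abs_diff power_mult_distrib power_divide)
    also have "\<dots> \<le> (R / \<eta>) ^ k * (exp (real (k + 1)) * fact k) / (fact j * fact (k - j))"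
      using kk R0 assms(2) by (intro divide_right_mono mult_left_mono) auto
    also have "\<dots> \<le> (R / \<eta>) ^ k * (exp (real (k + 1)) * (2 ^ k * (fact j * fact (k - j)))) / (fact j * fact (k - j))"
      using fact R0 assms(2) by (intro divide_right_mono mult_left_mono) auto
    also have "\<dots> = (R / \<eta>) ^ k * (exp 1 * exp 1 ^ k * 2 ^ k)"
      by (simp add: exp_add mult_ac flip: exp_of_nat_mult)
    also have "\<dots> = exp 1 * (2 * exp 1 * R / \<eta>) ^ k"
      by (simp add: power_mult_distrib power_divide)
    finally show ?thesis .
  qed
  ultimately show ?thesis by (rule polydisc_series_mono)
qed

section \<open>Interpolation in several variables\<close>

definition cube :: "real^'n \<Rightarrow> real \<Rightarrow> (real^'n) set" where
  "cube v \<eta> = {x. \<forall>i. \<bar>x $ i - v $ i\<bar> < \<eta>}"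

lemma cube_eq_box: "cube v \<eta> = box (\<chi> i. v $ i - \<eta>) (\<chi> i. v $ i + \<eta>)"
  by (auto simp: cube_def mem_box_cart abs_less_iff algebra_simps)

lemma open_cube: "open (cube v \<eta>)"
  unfolding cube_eq_box by (rule open_box)

definition update_coord :: "real^'n \<Rightarrow> 'n \<Rightarrow> real \<Rightarrow> real^'n" where
  "update_coord x j \<sigma> = (\<chi> i. if i = j then \<sigma> else x $ i)"

lemma update_coord_eq: "update_coord x j \<sigma> = x + (\<sigma> - x $ j) *\<^sub>R axis j 1"
  by (simp add: update_coord_def vec_eq_iff axis_def)

text \<open>Lagrange interpolation frees one coordinate at a time. Each coordinate costs
  \<open>k + 1\<close> summands and one factor of norm \<open>K\<close>, and the process starts from
  the values of \<open>h\<close> on the finite grid of nodes. The resulting \<open>H\<close> has a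
  bound on the whole polydisc, even beyond the cube.\<close>

lemma polydisc_series_of_separately_polynomial:
  fixes h :: "real^'n \<Rightarrow> real"
  assumes "\<eta> > 0" "\<rho> > 0"
    and poly: "\<And>x j. x \<in> cube v \<eta> \<Longrightarrow>
      \<exists>P. degree P \<le> k \<and> (\<forall>\<sigma>. \<bar>\<sigma> - v $ j\<bar> < \<eta> \<longrightarrow> h (update_coord x j \<sigma>) = poly P \<sigma>)"
    and M: "\<And>y. \<forall>i. y $ i - v $ i \<in> nodes \<eta> k ` {..k} \<Longrightarrow> \<bar>h y\<bar> \<le> M"
    and K: "\<And>i j. j \<le> k \<Longrightarrow> polydisc_series \<rho> K (\<lambda>x::real^'n. lagrange (nodes \<eta> k) k j (x $ i - v $ i))"
  shows "\<exists>H. polydisc_series \<rho> ((real (k + 1) * K) ^ CARD('n) * M) H \<and> (\<forall>x\<in>cube v \<eta>. h x = H x)"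
proof -
  \<comment> \<open>Coordinates in \<open>A\<close> are free and come from \<open>x\<close>; the
    others are frozen at nodes and come from \<open>y\<close>.\<close>
  define mix :: "'n set \<Rightarrow> real^'n \<Rightarrow> real^'n \<Rightarrow> real^'n"
    where "mix A x y = (\<chi> i. if i \<in> A then x $ i else y $ i)" for A x y
  let ?\<theta> = "nodes \<eta> k"
  have "\<forall>y. (\<forall>i. i \<notin> A \<longrightarrow> y $ i - v $ i \<in> ?\<theta> ` {..k}) \<longrightarrow>
     (\<exists>H. polydisc_series \<rho> ((real (k + 1) * K) ^ card A * M) H \<and> (\<forall>x\<in>cube v \<eta>. h (mix A x y) = H x))" for A
  proof (induction A rule: finite_induct[OF finite])
    case 1
    show ?case
    proof (intro allI impI)
      fix y :: "real^'n" assume y: "\<forall>i. i \<notin> {} \<longrightarrow> y $ i - v $ i \<in> ?\<theta> ` {..k}"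
      have "polydisc_series \<rho> M (\<lambda>x::real^'n. h y)"
        by (rule polydisc_series_mono[OF polydisc_series_const[OF assms(2)] M]) (use y in simp)
      moreover have "mix {} x y = y" for x by (simp add: mix_def vec_eq_iff)
      ultimately show "\<exists>H. polydisc_series \<rho> ((real (k + 1) * K) ^ card {} * M) H \<and> (\<forall>x\<in>cube v \<eta>. h (mix {} x y) = H x)"
        by auto
    qed
  next
    case (2 a A)
    show ?case
    proof (intro allI impI)
      fix y :: "real^'n" assume y: "\<forall>i. i \<notin> insert a A \<longrightarrow> y $ i - v $ i \<in> ?\<theta> ` {..k}"
      define z where "z j = update_coord y a (v $ a + ?\<theta> j)" for j
      have "\<forall>j\<in>{..k}. \<exists>H. polydisc_series \<rho> ((real (k + 1) * K) ^ card A * M) H \<and> (\<forall>x\<in>cube v \<eta>. h (mix A x (z j)) = H x)"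
      proof
        fix j assume "j \<in> {..k}"
        then have "\<forall>i. i \<notin> A \<longrightarrow> z j $ i - v $ i \<in> ?\<theta> ` {..k}"
          using y by (auto simp: z_def update_coord_def)
        then show "\<exists>H. polydisc_series \<rho> ((real (k + 1) * K) ^ card A * M) H \<and> (\<forall>x\<in>cube v \<eta>. h (mix A x (z j)) = H x)"
          using 2(3) by blast
      qed
      then obtain H where H: "\<And>j. j \<le> k \<Longrightarrow> polydisc_series \<rho> ((real (k + 1) * K) ^ card A * M) (H j)"
        "\<And>j x. j \<le> k \<Longrightarrow> x \<in> cube v \<eta> \<Longrightarrow> h (mix A x (z j)) = H j x"
        by (metis atMost_iff)
      define G where "G x = (\<Sum>j\<le>k. H j x * lagrange ?\<theta> k j (x $ a - v $ a))" for x
      have "polydisc_series \<rho> (\<Sum>j\<le>k. ((real (k + 1) * K) ^ card A * M) * K) G"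
        unfolding G_def by (intro polydisc_series_sum polydisc_series_mult assms(2) H K) auto
      then have "polydisc_series \<rho> ((real (k + 1) * K) ^ card (insert a A) * M) G"
        using 2 by (simp add: mult_ac)
      moreover have "h (mix (insert a A) x y) = G x" if x: "x \<in> cube v \<eta>" for x
      proof -
        have nb: "\<bar>?\<theta> j\<bar> < \<eta>" if "j \<le> k" for j by (rule nodes_bound[OF assms(1) that])
        have "mix (insert a A) x y \<in> cube v \<eta>"
          using x y nb unfolding cube_def mix_def by auto
        then obtain P where P: "degree P \<le> k"
          "\<And>\<sigma>. \<bar>\<sigma> - v $ a\<bar> < \<eta> \<Longrightarrow> h (update_coord (mix (insert a A) x y) a \<sigma>) = poly P \<sigma>"
          using poly by blast
        \<comment> \<open>Shifting the variable by \<open>v $ a\<close> matches the nodes, which are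
          measured from the centre of the cube.\<close>
        define P' where "P' = pcompose P [:v $ a, 1:]"
        have "degree P' \<le> k" using P(1) by (simp add: P'_def degree_pcompose)
        have P': "poly P' s = h (update_coord (mix (insert a A) x y) a (v $ a + s))" if "\<bar>s\<bar> < \<eta>" for s
          using P(2)[of "v $ a + s"] that by (simp add: P'_def poly_pcompose)
        have mz: "update_coord (mix (insert a A) x y) a (v $ a + ?\<theta> j) = mix A x (z j)" for j
          using 2(2) by (auto simp: update_coord_def mix_def z_def vec_eq_iff)
        have "update_coord (mix (insert a A) x y) a (v $ a + (x $ a - v $ a)) = mix (insert a A) x y"
          by (auto simp: update_coord_def mix_def vec_eq_iff)
        then have "h (mix (insert a A) x y) = poly P' (x $ a - v $ a)"
          using P'[of "x $ a - v $ a"] x by (simp add: cube_def)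
        also have "\<dots> = (\<Sum>j\<le>k. poly P' (?\<theta> j) * lagrange ?\<theta> k j (x $ a - v $ a))"
          by (rule lagrange_interpolation[OF \<open>degree P' \<le> k\<close> nodes_inj[OF assms(1)]])
        also have "\<dots> = G x"
          unfolding G_def using P'[OF nb] H(2)[OF _ x] mz by (intro sum.cong) auto
        finally show ?thesis .
      qed
      ultimately show "\<exists>H. polydisc_series \<rho> ((real (k + 1) * K) ^ card (insert a A) * M) H \<and>
          (\<forall>x\<in>cube v \<eta>. h (mix (insert a A) x y) = H x)" by blast
    qed
  qed
  from this[of UNIV] have "\<exists>H. polydisc_series \<rho> ((real (k + 1) * K) ^ CARD('n) * M) H \<and> (\<forall>x\<in>cube v \<eta>. h (mix UNIV x v) = H x)"
    by blast
  moreover have "mix UNIV x v = x" for x by (simp add: mix_def)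
  ultimately show ?thesis by (simp only:)
qed

lemma finite_grid: "finite S \<Longrightarrow> finite {y :: real^'n. \<forall>i. y $ i - v $ i \<in> S}"
proof (rule finite_surj[where f="\<lambda>J. \<chi> i. v $ i + J i"])
  assume "finite S"
  then show "finite (UNIV \<rightarrow>\<^sub>E S :: ('n \<Rightarrow> real) set)" by (intro finite_PiE) auto
  show "{y :: real^'n. \<forall>i. y $ i - v $ i \<in> S} \<subseteq> (\<lambda>J. \<chi> i. v $ i + J i) ` (UNIV \<rightarrow>\<^sub>E S)"
  proof
    fix y :: "real^'n" assume "y \<in> {y. \<forall>i. y $ i - v $ i \<in> S}"
    then show "y \<in> (\<lambda>J. \<chi> i. v $ i + J i) ` (UNIV \<rightarrow>\<^sub>E S)"
      by (intro image_eqI[of _ _ "\<lambda>i. y $ i - v $ i"]) (auto simp: vec_eq_iff)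
  qed
qed

text \<open>The grid is finite, so a bound at the nodes exists without any regularity of
  \<open>h\<close>, and interpolation applies. The continuity gained here is what the Baire argument
  needs to obtain closed sets.\<close>

lemma continuous_on_separately_polynomial:
  fixes h :: "real^'n \<Rightarrow> real"
  assumes "\<eta> > 0"
    and poly: "\<And>x j. x \<in> cube v \<eta> \<Longrightarrow>
      \<exists>P. degree P \<le> k \<and> (\<forall>\<sigma>. \<bar>\<sigma> - v $ j\<bar> < \<eta> \<longrightarrow> h (update_coord x j \<sigma>) = poly P \<sigma>)"
  shows "continuous_on (cube v \<eta>) h"
proof -
  define \<rho> where "\<rho> = norm v + \<eta>"
  have \<rho>: "\<rho> > 0" using assms(1) by (simp add: \<rho>_def add_nonneg_pos)
  define Y where "Y = {y :: real^'n. \<forall>i. y $ i - v $ i \<in> nodes \<eta> k ` {..k}}"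
  have "finite Y" unfolding Y_def by (rule finite_grid) simp
  then have M: "\<bar>h y\<bar> \<le> Max (insert 0 ((\<lambda>y. \<bar>h y\<bar>) ` Y))" if "\<forall>i. y $ i - v $ i \<in> nodes \<eta> k ` {..k}" for y
    using that by (intro Max_ge) (auto simp: Y_def)
  have R: "\<rho> + \<bar>v $ i\<bar> + \<eta> \<le> \<rho> + norm v + \<eta>" for i
    using component_le_norm_cart[of v i] by simp
  obtain N H where H: "polydisc_series \<rho> N H" "\<And>x. x \<in> cube v \<eta> \<Longrightarrow> h x = H x"
    using polydisc_series_of_separately_polynomial[OF assms(1) \<rho> poly M polydisc_series_lagrange[OF \<rho> assms(1) _ R]] by auto
  have "isCont H x" if "x \<in> cube v \<eta>" for x
  proof (rule real_analytic_at_isCont[OF polydisc_series_real_analytic_at[OF \<rho> H(1)]])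
    show "\<bar>x $ i\<bar> < \<rho>" for i
      using that component_le_norm_cart[of v i] unfolding cube_def \<rho>_def by (smt (verit) mem_Collect_eq)
  qed
  then have "continuous_on (cube v \<eta>) H" by (simp add: continuous_at_imp_continuous_on)
  then show ?thesis using H(2) by (metis continuous_on_cong)
qed

lemma polydisc_series_with_homogeneous_part:
  fixes u :: "real^'n \<Rightarrow> real"
  assumes "polydisc_series_with c \<rho> N u" "\<rho> > 0"
  shows "polydisc_series_with (\<lambda>\<alpha>. if deg \<alpha> = k then c \<alpha> else 0) \<rho> N (homogeneous_part c k)"
proof -
  obtain M where M: "M \<le> N" "((\<lambda>\<alpha>. \<bar>c \<alpha>\<bar> * \<rho> ^ deg \<alpha>) has_sum M) UNIV"
    using assms(1) unfolding polydisc_series_with_def by blast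
  let ?d = "\<lambda>\<alpha>. if deg \<alpha> = k then c \<alpha> else 0"
  have h: "((\<lambda>\<alpha>. \<bar>?d \<alpha>\<bar> * \<rho> ^ deg \<alpha>) has_sum (\<Sum>\<alpha> | deg \<alpha> = k. \<bar>c \<alpha>\<bar> * \<rho> ^ deg \<alpha>)) UNIV"
    by (rule has_sum_finite_neutralI[OF finite_deg[of k]]) (auto intro!: sum.cong)
  have "(\<Sum>\<alpha> | deg \<alpha> = k. \<bar>c \<alpha>\<bar> * \<rho> ^ deg \<alpha>) \<le> M"
    by (rule has_sum_mono[OF h M(2)]) (use assms(2) in auto)
  moreover have "((\<lambda>\<alpha>. ?d \<alpha> * monomial_at x \<alpha>) has_sum homogeneous_part c k x) UNIV" for x
    unfolding homogeneous_part_def by (rule has_sum_finite_neutralI[OF finite_deg[of k]]) (auto intro!: sum.cong)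
  ultimately show ?thesis using h M(1) unfolding polydisc_series_with_def by (meson order_trans)
qed

section \<open>Taylor coefficients along lines and their uniform growth\<close>

definition plane :: "real^'n \<Rightarrow> real^'n \<Rightarrow> real^2 \<Rightarrow> real^'n" where
  "plane u v x = x $ 1 *\<^sub>R u + x $ 2 *\<^sub>R v"

lemma plane_scale: "plane u v (t *\<^sub>R vector [s, 1]) = t *\<^sub>R (v + s *\<^sub>R u)"
  by (simp add: plane_def algebra_simps)

text \<open>The direction \<open>v + s *\<^sub>R u\<close> has plane coordinates
  \<open>(s, 1)\<close>. The degree-\<open>k\<close> homogeneous part of the two-variable expansion
  at \<open>(s, 1)\<close> is a polynomial in \<open>s\<close> of degree at most
  \<open>k\<close>.\<close>

lemma plane_series:
  fixes g :: "real^'n \<Rightarrow> real"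
  assumes "real_analytic_at (\<lambda>x. g (plane u v x)) 0"
  obtains P where "\<And>k. degree (P k) \<le> k"
    "\<And>s. \<exists>r>0. \<forall>t. \<bar>t\<bar> < r \<longrightarrow> (\<lambda>k. poly (P k) s * t ^ k) sums g (t *\<^sub>R (v + s *\<^sub>R u))"
proof -
  obtain \<rho> N c where \<rho>: "\<rho> > 0" and c: "polydisc_series_with c \<rho> N (\<lambda>x. g (plane u v x))"
    using assms unfolding real_analytic_at_iff polydisc_series_def by auto
  define P where "P k = (\<Sum>\<alpha> | deg \<alpha> = k. monom (c \<alpha>) (\<alpha> (1::2)))" for k
  have le: "\<alpha> (1::2) \<le> deg \<alpha>" for \<alpha> by (rule member_le_sum) auto
  have "degree (P k) \<le> k" for k
    unfolding P_def
    by (intro degree_sum_le finite_deg order_trans[OF degree_monom_le]) (use le in auto)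
  moreover have "\<exists>r>0. \<forall>t. \<bar>t\<bar> < r \<longrightarrow> (\<lambda>k. poly (P k) s * t ^ k) sums g (t *\<^sub>R (v + s *\<^sub>R u))" for s
  \<comment> \<open>This radius keeps both coordinates \<open>t * s\<close> and \<open>t\<close>
    inside the polydisc.\<close>
  proof (intro exI[of _ "\<rho> / (\<bar>s\<bar> + 1)"] conjI allI impI)
    show "0 < \<rho> / (\<bar>s\<bar> + 1)" using \<rho> by simp
    fix t assume "\<bar>t\<bar> < \<rho> / (\<bar>s\<bar> + 1)"
    then have t: "\<bar>t\<bar> * (\<bar>s\<bar> + 1) < \<rho>" by (simp add: field_simps)
    have "\<bar>t\<bar> * \<bar>s\<bar> \<le> \<bar>t\<bar> * (\<bar>s\<bar> + 1)" "\<bar>t\<bar> \<le> \<bar>t\<bar> * (\<bar>s\<bar> + 1)"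
      by (auto simp: distrib_left)
    with t have "\<forall>i. \<bar>t * (vector [s, 1] :: real^2) $ i\<bar> \<le> \<rho>"
      by (auto simp: forall_2 abs_mult)
    from polydisc_series_with_homogeneous_part_sums[OF c this]
    have "(\<lambda>k. homogeneous_part c k (vector [s, 1]) * t ^ k) sums g (t *\<^sub>R (v + s *\<^sub>R u))"
      by (simp only: plane_scale)
    moreover have "homogeneous_part c k (vector [s, 1]) = poly (P k) s" for k
      unfolding homogeneous_part_def P_def poly_sum poly_monom
      by (rule sum.cong) (auto simp: monomial_at_def UNIV_2)
    ultimately show "(\<lambda>k. poly (P k) s * t ^ k) sums g (t *\<^sub>R (v + s *\<^sub>R u))" by simp
  qed
  ultimately show thesis by (rule that)
qed

text \<open>The terms of a convergent series are bounded. One natural number serves as both constant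
  and ratio, so that the Baire argument has a countable family of bounds.\<close>

lemma sums_power_bound:
  fixes a :: "nat \<Rightarrow> real"
  assumes "r > 0" "\<And>h. \<bar>h\<bar> < r \<Longrightarrow> (\<lambda>k. a k * h ^ k) sums \<phi> h"
  shows "\<exists>M::nat. \<forall>k. \<bar>a k\<bar> \<le> real M * real M ^ k"
proof -
  have "summable (\<lambda>k. a k * (r/2) ^ k)" using assms(2)[of "r/2"] assms(1) by (auto simp: sums_iff)
  then have "Bseq (\<lambda>k. a k * (r/2) ^ k)"
    using summable_LIMSEQ_zero convergent_def convergent_imp_Bseq by blast
  then obtain C where C: "C > 0" "\<And>k. \<bar>a k * (r/2) ^ k\<bar> \<le> C"
    unfolding Bseq_def by auto
  obtain M :: nat where M: "C \<le> real M" "2 / r \<le> real M"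
    using real_arch_simple[of "max C (2 / r)"] by auto
  have "\<bar>a k\<bar> \<le> real M * real M ^ k" for k
  proof -
    have "\<bar>a k\<bar> * (r/2) ^ k \<le> C" using C(2)[of k] assms(1) by (simp add: abs_mult)
    then have "\<bar>a k\<bar> \<le> C * (2 / r) ^ k" using assms(1) by (simp add: power_divide field_simps)
    also have "\<dots> \<le> real M * real M ^ k"
      using M C(1) assms(1) by (intro mult_mono power_mono) auto
    finally show ?thesis .
  qed
  then show ?thesis by blast
qed

lemma cube_subset_ball:
  fixes v :: "real^'n"
  assumes "e > 0"
  shows "cube v (e / (2 * CARD('n))) \<subseteq> ball v e"
proof
  fix x assume "x \<in> cube v (e / (2 * CARD('n)))"
  then have "\<forall>i. \<bar>(x - v) $ i\<bar> \<le> e / (2 * CARD('n))"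
    unfolding cube_def by (auto intro: less_imp_le)
  from norm_less_of_components[OF assms this] show "x \<in> ball v e"
    by (simp add: dist_norm norm_minus_commute)
qed

text \<open>By continuity the sets \<open>D M\<close> are relatively closed, and by the pointwise
  bounds they cover the closed cube \<open>S\<close>. Baire's theorem gives one of them relative
  interior in \<open>S\<close>, which contains a smaller cube.\<close>

lemma uniform_power_bound:
  fixes a :: "real^'n \<Rightarrow> nat \<Rightarrow> real"
  assumes "\<epsilon> > 0"
    and cont: "\<And>k. continuous_on (cube v0 \<epsilon>) (\<lambda>v. a v k)"
    and bound: "\<And>v. v \<in> cube v0 \<epsilon> \<Longrightarrow> \<exists>M::nat. \<forall>k. \<bar>a v k\<bar> \<le> real M * real M ^ k"
  obtains v1 \<eta> M where "\<eta> > 0" "cube v1 \<eta> \<subseteq> cube v0 \<epsilon>"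
    "\<And>v k. v \<in> cube v1 \<eta> \<Longrightarrow> \<bar>a v k\<bar> \<le> real M * real M ^ k"
proof -
  define S where "S = {x. \<forall>i. \<bar>x $ i - v0 $ i\<bar> \<le> \<epsilon> / 2}"
  have "closed S"
    unfolding S_def by (intro closed_Collect_all closed_Collect_le continuous_intros)
  have S: "S \<subseteq> cube v0 \<epsilon>"
  proof
    fix x assume x: "x \<in> S"
    have "\<bar>x $ i - v0 $ i\<bar> < \<epsilon>" for i
    proof -
      have "\<bar>x $ i - v0 $ i\<bar> \<le> \<epsilon> / 2" using x by (simp add: S_def)
      then show ?thesis using assms(1) by linarith
    qed
    then show "x \<in> cube v0 \<epsilon>" by (simp add: cube_def)
  qed
  define D where "D M = {v\<in>S. \<forall>k. \<bar>a v k\<bar> \<le> real M * real M ^ k}" for M :: nat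
  have closedD: "closedin (top_of_set S) (D M)" for M
  proof -
    have "closedin (top_of_set S) (S \<inter> (\<lambda>v. \<bar>a v k\<bar>) -` {..real M * real M ^ k})" for k
      by (intro continuous_closedin_preimage continuous_on_rabs continuous_on_subset[OF cont S] closed_atMost)
    then have "closedin (top_of_set S) (\<Inter>k. S \<inter> (\<lambda>v. \<bar>a v k\<bar>) -` {..real M * real M ^ k})"
      by (intro closedin_Inter) auto
    moreover have "D M = (\<Inter>k. S \<inter> (\<lambda>v. \<bar>a v k\<bar>) -` {..real M * real M ^ k})"
      by (auto simp: D_def)
    ultimately show ?thesis by simp
  qed
  have "\<exists>M. \<not> S \<subseteq> closure (S - D M)"
  proof (rule ccontr)
    assume "\<nexists>M. \<not> S \<subseteq> closure (S - D M)"
    then have dense: "\<And>M. S \<subseteq> closure (S - D M)" by blast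
    have "S \<subseteq> closure (\<Inter>(range (\<lambda>M. S - D M)))"
    proof (rule Baire[OF \<open>closed S\<close>])
      fix T assume "T \<in> range (\<lambda>M. S - D M)"
      then obtain M where "T = S - D M" by blast
      then show "openin (top_of_set S) T \<and> S \<subseteq> closure T"
        using closedD[of M] dense[of M] openin_diff[of "top_of_set S" S] by auto
    qed auto
    moreover have "\<Inter>(range (\<lambda>M. S - D M)) = {}"
    proof (rule ccontr)
      assume "\<Inter>(range (\<lambda>M. S - D M)) \<noteq> {}"
      then obtain x where x: "\<And>M. x \<in> S - D M" by blast
      then have "x \<in> cube v0 \<epsilon>" using S by blast
      from bound[OF this] obtain M where "x \<in> D M" using x by (auto simp: D_def)
      then show False using x by blast
    qed
    moreover have "v0 \<in> S" using assms(1) by (simp add: S_def)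
    ultimately show False by (metis closure_empty empty_iff subsetD)
  qed
  then obtain M x where x: "x \<in> S" "x \<notin> closure (S - D M)" by blast
  have "open (- closure (S - D M))" by (rule open_Compl[OF closed_closure])
  then obtain e where "e > 0" "ball x e \<subseteq> - closure (S - D M)"
    using x(2) open_contains_ball by blast
  then have e: "e > 0" "ball x e \<inter> (S - D M) = {}"
    using closure_subset[of "S - D M"] by auto
  \<comment> \<open>The relative interior point \<open>x\<close> may lie on the boundary of
    \<open>S\<close>; a small move towards the centre \<open>v0\<close> stays in the ball around
    \<open>x\<close> and enters the open cube.\<close>
  define d where "d = min 1 (e / (norm (v0 - x) + 1))"
  have d: "0 < d" "d \<le> 1" using e(1) by (auto simp: d_def add_nonneg_pos)
  have "d * norm (v0 - x) < e"
  proof -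
    have "d * norm (v0 - x) \<le> e / (norm (v0 - x) + 1) * norm (v0 - x)"
      by (intro mult_right_mono) (auto simp: d_def)
    also have "\<dots> = e * (norm (v0 - x) / (norm (v0 - x) + 1))" by simp
    also have "\<dots> < e * 1" using e(1) by (intro mult_strict_left_mono) (auto simp: divide_less_eq add_nonneg_pos)
    finally show ?thesis by simp
  qed
  define v1 where "v1 = x + d *\<^sub>R (v0 - x)"
  have "v1 \<in> ball x e"
    using \<open>d * norm (v0 - x) < e\<close> d by (simp add: v1_def dist_norm)
  moreover have "v1 \<in> cube v0 (\<epsilon> / 2)"
    unfolding cube_def mem_Collect_eq
  proof
    fix i
    have "v1 $ i - v0 $ i = (1 - d) * (x $ i - v0 $ i)" by (simp add: v1_def algebra_simps)
    then have "\<bar>v1 $ i - v0 $ i\<bar> = (1 - d) * \<bar>x $ i - v0 $ i\<bar>" using d by (simp add: abs_mult)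
    also have "\<dots> \<le> (1 - d) * (\<epsilon> / 2)" using x(1) d by (intro mult_left_mono) (auto simp: S_def)
    also have "\<dots> < 1 * (\<epsilon> / 2)" using d assms(1) by (intro mult_strict_right_mono) auto
    finally show "\<bar>v1 $ i - v0 $ i\<bar> < \<epsilon> / 2" by simp
  qed
  ultimately have "open (ball x e \<inter> cube v0 (\<epsilon> / 2))" "v1 \<in> ball x e \<inter> cube v0 (\<epsilon> / 2)"
    by (auto intro: open_cube)
  then obtain e' where e': "e' > 0" "ball v1 e' \<subseteq> ball x e \<inter> cube v0 (\<epsilon> / 2)"
    using open_contains_ball by blast
  have "cube v0 (\<epsilon> / 2) \<subseteq> S" by (auto simp: cube_def S_def intro: less_imp_le)
  then have "cube v1 (e' / (2 * CARD('n))) \<subseteq> ball x e \<inter> S"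
    using cube_subset_ball[OF e'(1), of v1] e'(2) by blast
  moreover have "ball x e \<inter> S \<subseteq> D M" using e(2) by blast
  ultimately show thesis
    by (intro that[of "e' / (2 * CARD('n))" v1 M]) (use e'(1) S in \<open>auto simp: D_def\<close>)
qed

subsection \<open>Extension from planes through a point\<close>

text \<open>From the \<open>k\<close>-th series only its degree-\<open>k\<close> part is kept. That
  part gains \<open>(\<rho>' / \<rho>) ^ k\<close> on the smaller polydisc, which turns
  \<open>B ^ k\<close> into at most \<open>(1/2) ^ k\<close> and makes the sum converge.\<close>

lemma homogeneous_parts_converge:
  fixes H :: "nat \<Rightarrow> real^'n \<Rightarrow> real"
  assumes "\<rho> > 0" "B > 0" and c: "\<And>k. polydisc_series_with (c k) \<rho> (A * B ^ k) (H k)"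
  obtains F where "real_analytic_at F 0"
    "\<exists>r>0. \<forall>x. norm x < r \<longrightarrow> (\<lambda>k. homogeneous_part (c k) k x) sums F x"
proof -
  define \<rho>' where "\<rho>' = min \<rho> (\<rho> / (2 * B))"
  have \<rho>': "0 < \<rho>'" "\<rho>' \<le> \<rho>" using assms by (auto simp: \<rho>'_def)
  have "0 \<le> A" using polydisc_series_nonneg[OF polydisc_series_with_polydisc_series[OF c[of 0]]] assms(1) by simp
  have small: "(\<rho>' / \<rho>) ^ k * (A * B ^ k) \<le> A * (1/2) ^ k" for k
  proof -
    have "\<rho>' / \<rho> * B \<le> (\<rho> / (2 * B)) / \<rho> * B"
      using assms by (intro mult_right_mono divide_right_mono) (auto simp: \<rho>'_def)
    then have "\<rho>' / \<rho> * B \<le> 1 / 2" using assms by simp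
    then have "(\<rho>' / \<rho> * B) ^ k \<le> (1 / 2) ^ k"
      using \<rho>' assms by (intro power_mono) auto
    from mult_left_mono[OF this \<open>0 \<le> A\<close>] show ?thesis
      unfolding power_mult_distrib by (simp only: mult_ac)
  qed
  have homogeneous_part: "polydisc_series \<rho>' (A * (1/2) ^ k) (homogeneous_part (c k) k)" for k
  proof -
    have "polydisc_series_with (\<lambda>\<alpha>. if deg \<alpha> = k then c k \<alpha> else 0) \<rho>' ((\<rho>' / \<rho>) ^ k * (A * B ^ k)) (homogeneous_part (c k) k)"
      by (rule polydisc_series_with_shrink[OF \<rho>' polydisc_series_with_homogeneous_part[OF c assms(1)]]) auto
    then show ?thesis using polydisc_series_with_mono[OF _ small] polydisc_series_with_polydisc_series by blast
  qed
  have geo: "((\<lambda>k. A * (1/2::real) ^ k) has_sum A * 2) UNIV"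
    using geometric_sums[of "1/2::real"]
    by (intro has_sum_cmult_right norm_summable_imp_has_sum) (auto simp: summable_geometric)
  define F where "F x = infsum (\<lambda>k. homogeneous_part (c k) k x) UNIV" for x
  have F: "((\<lambda>k. homogeneous_part (c k) k x) has_sum F x) UNIV" if "\<forall>i. \<bar>x $ i\<bar> \<le> \<rho>'" for x
  proof -
    have "(\<lambda>k. norm (homogeneous_part (c k) k x)) summable_on UNIV"
      by (rule Infinite_Sum.abs_summable_on_comparison_test'[OF has_sum_imp_summable[OF geo]])
         (use polydisc_series_abs_le[OF homogeneous_part that] in simp)
    then show ?thesis unfolding F_def by (simp add: abs_summable_summable)
  qed
  have "polydisc_series \<rho>' (A * 2) F"
    by (rule polydisc_series_has_sum[OF \<rho>'(1) homogeneous_part geo F])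
  then have "real_analytic_at F 0"
    by (rule polydisc_series_real_analytic_at[OF \<rho>'(1)]) (use \<rho>' in simp)
  moreover have "(\<lambda>k. homogeneous_part (c k) k x) sums F x" if "norm x < \<rho>'" for x
  proof -
    have "\<forall>i. \<bar>x $ i\<bar> \<le> \<rho>'"
      using that component_le_norm_cart[of x] by (meson less_imp_le order_trans)
    from has_sum_imp_sums[OF F[OF this]] show ?thesis .
  qed
  ultimately show thesis using that \<rho>'(1) by blast
qed

text \<open>Homogeneity is known only for scalars near 1, since the interpolated function is
  controlled only on a cube. The identity theorem along the segment from \<open>v\<close> to 0
  carries it to scalars near 0, where Taylor coefficients can be compared.\<close>

lemma homogeneous_part_eq_of_homogeneous:
  fixes H :: "real^'n \<Rightarrow> real"
  assumes "\<rho> > 0" "polydisc_series_with c \<rho> N H" "\<And>i. \<bar>v $ i\<bar> < \<rho>"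
    and "\<forall>\<^sub>F t in nhds 1. H (t *\<^sub>R v) = t ^ k * H v"
  shows "homogeneous_part c k v = H v"
proof -
  have tv: "\<bar>t * v $ i\<bar> < \<rho>" if "t \<in> {0..1}" for t i
  proof -
    have "\<bar>t * v $ i\<bar> \<le> 1 * \<bar>v $ i\<bar>" using that unfolding abs_mult by (intro mult_right_mono) auto
    then show ?thesis using assms(3)[of i] by linarith
  qed
  have 1: "analytic1 (\<lambda>s. H (0 + s *\<^sub>R v)) t" if "t \<in> {0..1}" for t
    by (intro analytic1_line polydisc_series_real_analytic_at[OF assms(1) polydisc_series_with_polydisc_series[OF assms(2)]]) (use tv that in simp)
  have 2: "analytic1 (\<lambda>s. s ^ k * H v) t" for t
    unfolding analytic1_def by (intro real_analytic_at_intros)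
  have "\<forall>\<^sub>F t in nhds 0. H (0 + t *\<^sub>R v) = t ^ k * H v"
    using analytic1_identity_eq[of "{0..1}", OF _ 1 2, of 1 0] assms(4) by simp
  then obtain d where d: "d > 0" "\<And>t. \<bar>t\<bar> < d \<Longrightarrow> H (t *\<^sub>R v) = t ^ k * H v"
    unfolding eventually_nhds_metric by auto
  have s1: "(\<lambda>j. homogeneous_part c j v * t ^ j) sums H (t *\<^sub>R v)" if "\<bar>t\<bar> < 1" for t
  proof (rule polydisc_series_with_homogeneous_part_sums[OF assms(2)])
    have "\<bar>t * v $ i\<bar> \<le> \<rho>" for i using tv[of "\<bar>t\<bar>" i] that by (simp add: abs_mult)
    then show "\<forall>i. \<bar>t * v $ i\<bar> \<le> \<rho>" by blast
  qed
  have s2: "(\<lambda>j. (if j = k then H v else 0) * t ^ j) sums H (t *\<^sub>R v)" if "\<bar>t\<bar> < d" for t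
    using sums_single[of k "\<lambda>j. H v * t ^ j"] d(2)[OF that]
    by (simp add: mult.commute if_distrib[of "\<lambda>x. _ * x"] cong: if_cong)
  have "homogeneous_part c k v = (if k = k then H v else 0)"
    by (rule powser_coeffs_unique[OF zero_less_one s1 d(1) s2])
  then show ?thesis by simp
qed

text \<open>Planes spanned by \<open>v\<close> and a coordinate axis suffice: changing one
  coordinate of \<open>v\<close> stays in such a plane. The coefficients \<open>a v k\<close> are
  thus separately polynomial in the direction, and interpolation with the Baire bound makes their
  homogeneous extensions summable.\<close>

proposition analytic_extension_from_planes:
  fixes g :: "real^'n \<Rightarrow> real"
  assumes "\<epsilon> > 0"
    and an: "\<And>v j. v \<in> cube v0 \<epsilon> \<Longrightarrow> real_analytic_at (\<lambda>x. g (plane (axis j 1) v x)) 0"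
  obtains F v1 \<eta> where "\<eta> > 0" "cube v1 \<eta> \<subseteq> cube v0 \<epsilon>" "real_analytic_at F 0"
    "\<forall>v\<in>cube v1 \<eta>. \<forall>\<^sub>F t in nhds 0. g (t *\<^sub>R v) = F (t *\<^sub>R v)"
proof -
  have "\<exists>a r. r > 0 \<and> (\<forall>t. \<bar>t\<bar> < r \<longrightarrow> (\<lambda>k. a k * t ^ k) sums g (t *\<^sub>R v))" if v: "v \<in> cube v0 \<epsilon>" for v
  proof -
    \<comment> \<open>Only the line in direction \<open>v\<close> itself is wanted here
      (\<open>s = 0\<close>), so the axis is an arbitrary one.\<close>
    obtain P where "\<exists>r>0. \<forall>t. \<bar>t\<bar> < r \<longrightarrow> (\<lambda>k. poly (P k) 0 * t ^ k) sums g (t *\<^sub>R (v + 0 *\<^sub>R axis undefined 1))"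
      using plane_series[OF an[OF v, of undefined]] by metis
    then obtain s where "s > 0" "\<forall>t. \<bar>t\<bar> < s \<longrightarrow> (\<lambda>k. poly (P k) 0 * t ^ k) sums g (t *\<^sub>R v)" by auto
    then show ?thesis by (intro exI[of _ "\<lambda>k. poly (P k) 0"] exI[of _ s]) blast
  qed
  then obtain a r where r: "\<And>v. v \<in> cube v0 \<epsilon> \<Longrightarrow> r v > 0"
    and a: "\<And>v t. v \<in> cube v0 \<epsilon> \<Longrightarrow> \<bar>t\<bar> < r v \<Longrightarrow> (\<lambda>k. a v k * t ^ k) sums g (t *\<^sub>R v)"
    by metis
  \<comment> \<open>All directions \<open>update_coord x j \<sigma>\<close> lie in the plane of
    \<open>x\<close> and the \<open>j\<close>-th axis. Uniqueness of coefficients identifies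
    \<open>a\<close> with the polynomial that this one plane provides.\<close>
  have poly0: "\<exists>P. degree P \<le> k \<and> (\<forall>\<sigma>. update_coord x j \<sigma> \<in> cube v0 \<epsilon> \<longrightarrow> a (update_coord x j \<sigma>) k = poly P \<sigma>)"
    if x: "x \<in> cube v0 \<epsilon>" for x j k
  proof -
    obtain P where P: "\<And>k. degree (P k) \<le> k"
      "\<And>s. \<exists>r>0. \<forall>t. \<bar>t\<bar> < r \<longrightarrow> (\<lambda>k. poly (P k) s * t ^ k) sums g (t *\<^sub>R (x + s *\<^sub>R axis j 1))"
      using plane_series[OF an[OF x, of j]] by metis
    define P' where "P' = pcompose (P k) [:- x $ j, 1:]"
    have "a (update_coord x j \<sigma>) k = poly P' \<sigma>" if u: "update_coord x j \<sigma> \<in> cube v0 \<epsilon>" for \<sigma>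
    proof -
      obtain s where s: "s > 0" "\<And>t. \<bar>t\<bar> < s \<Longrightarrow> (\<lambda>k. poly (P k) (\<sigma> - x $ j) * t ^ k) sums g (t *\<^sub>R update_coord x j \<sigma>)"
        using P(2)[of "\<sigma> - x $ j"] unfolding update_coord_eq by blast
      have "a (update_coord x j \<sigma>) k = poly (P k) (\<sigma> - x $ j)"
        by (rule powser_coeffs_unique[OF r[OF u] a[OF u] s])
      then show ?thesis by (simp add: P'_def poly_pcompose)
    qed
    moreover have "degree P' \<le> k" using P(1)[of k] by (simp add: P'_def degree_pcompose)
    ultimately show ?thesis by blast
  qed
  have poly: "\<exists>P. degree P \<le> k \<and> (\<forall>\<sigma>. \<bar>\<sigma> - v $ j\<bar> < \<delta> \<longrightarrow> a (update_coord x j \<sigma>) k = poly P \<sigma>)"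
    if "cube v \<delta> \<subseteq> cube v0 \<epsilon>" "x \<in> cube v \<delta>" for v \<delta> x j k
  proof -
    have "update_coord x j \<sigma> \<in> cube v0 \<epsilon>" if "\<bar>\<sigma> - v $ j\<bar> < \<delta>" for \<sigma>
    proof -
      have "update_coord x j \<sigma> \<in> cube v \<delta>" using \<open>x \<in> cube v \<delta>\<close> that by (simp add: cube_def update_coord_def)
      then show ?thesis using \<open>cube v \<delta> \<subseteq> cube v0 \<epsilon>\<close> by blast
    qed
    then show ?thesis using poly0[of x] that by (meson subsetD)
  qed
  \<comment> \<open>Proportional directions parametrise the same line, so uniqueness of coefficients
    applies after rescaling the parameter.\<close>
  have homog: "a (\<mu> *\<^sub>R v) k = \<mu> ^ k * a v k" if "v \<in> cube v0 \<epsilon>" "\<mu> *\<^sub>R v \<in> cube v0 \<epsilon>" "\<mu> \<noteq> 0" for v \<mu> k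
  proof (rule powser_coeffs_unique[OF r[OF that(2)] a[OF that(2)]])
    show "0 < r v / \<bar>\<mu>\<bar>" using r[OF that(1)] that(3) by simp
    fix h assume "\<bar>h\<bar> < r v / \<bar>\<mu>\<bar>"
    then have "\<bar>h * \<mu>\<bar> < r v" using that(3) by (simp add: abs_mult field_simps)
    from a[OF that(1) this] show "(\<lambda>k. \<mu> ^ k * a v k * h ^ k) sums g (h *\<^sub>R \<mu> *\<^sub>R v)"
      by (simp add: power_mult_distrib mult_ac)
  qed
  have "continuous_on (cube v0 \<epsilon>) (\<lambda>v. a v k)" for k
    by (rule continuous_on_separately_polynomial[OF assms(1) poly]) auto
  moreover have "\<exists>M::nat. \<forall>k. \<bar>a v k\<bar> \<le> real M * real M ^ k" if "v \<in> cube v0 \<epsilon>" for v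
    by (rule sums_power_bound[OF r a]) (use that in auto)
  ultimately obtain v1 \<eta> M where \<eta>: "\<eta> > 0" and sub: "cube v1 \<eta> \<subseteq> cube v0 \<epsilon>"
    and M: "\<And>v k. v \<in> cube v1 \<eta> \<Longrightarrow> \<bar>a v k\<bar> \<le> real M * real M ^ k"
    using uniform_power_bound[OF assms(1)] by metis
  \<comment> \<open>Large enough for the polydisc to contain \<open>cube v1 \<eta>\<close>.\<close>
  define \<rho> where "\<rho> = norm v1 + \<eta>"
  have \<rho>: "\<rho> > 0" using \<eta> by (simp add: \<rho>_def add_nonneg_pos)
  define R where "R = \<rho> + norm v1 + \<eta>"
  have R: "\<rho> + \<bar>v1 $ i\<bar> + \<eta> \<le> R" for i
    using component_le_norm_cart[of v1 i] by (simp add: R_def)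
  define N where "N = CARD('n)"
  define A where "A = exp 1 ^ N * real M"
  define Q where "Q = 2 * exp 1 * R / \<eta>"
  \<comment> \<open>The factor 2 absorbs \<open>k + 1 \<le> 2 ^ k\<close>; the added 1 keeps
    \<open>B\<close> positive even when \<open>M = 0\<close>.\<close>
  define B where "B = (2 * Q) ^ N * real M + 1"
  have "R > 0" using \<rho> \<eta> by (simp add: R_def add_pos_nonneg)
  then have Q: "Q > 0" using \<eta> by (simp add: Q_def)
  then have B: "B > 0" by (auto simp: B_def intro!: add_nonneg_pos)
  have "\<exists>H. polydisc_series \<rho> (A * B ^ k) H \<and> (\<forall>x\<in>cube v1 \<eta>. a x k = H x)" for k
  proof -
    have nodes: "\<bar>a y k\<bar> \<le> real M * real M ^ k" if "\<forall>i. y $ i - v1 $ i \<in> nodes \<eta> k ` {..k}" for y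
    proof (rule M)
      show "y \<in> cube v1 \<eta>" unfolding cube_def
        using that nodes_bound[OF \<eta>] by (smt (verit) atMost_iff imageE mem_Collect_eq)
    qed
    define K where "K = exp 1 * Q ^ k"
    have "K \<ge> 0" using Q by (simp add: K_def)
    have "real (k + 1) \<le> 2 ^ k" by (induction k) auto
    then have "(real (k + 1) * K) ^ N * (real M * real M ^ k) \<le> (2 ^ k * K) ^ N * (real M * real M ^ k)"
      using \<open>K \<ge> 0\<close> by (intro mult_right_mono power_mono) auto
    also have "\<dots> = A * ((2 * Q) ^ N * real M) ^ k"
      by (simp add: K_def A_def power_mult_distrib mult_ac flip: power_mult)
    also have "\<dots> \<le> A * B ^ k"
      using Q by (intro mult_left_mono power_mono) (auto simp: A_def B_def)
    finally have "(real (k + 1) * K) ^ N * (real M * real M ^ k) \<le> A * B ^ k" .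
    moreover obtain H where "polydisc_series \<rho> ((real (k + 1) * K) ^ N * (real M * real M ^ k)) H" "\<forall>x\<in>cube v1 \<eta>. a x k = H x"
      using polydisc_series_of_separately_polynomial[OF \<eta> \<rho> poly[OF sub] nodes polydisc_series_lagrange[OF \<rho> \<eta> _ R]]
      unfolding K_def N_def Q_def by blast
    ultimately show ?thesis using polydisc_series_mono by blast
  qed
  then have "\<forall>k. \<exists>H c. polydisc_series_with c \<rho> (A * B ^ k) H \<and> (\<forall>x\<in>cube v1 \<eta>. a x k = H x)"
    unfolding polydisc_series_def by blast
  then obtain H c where c: "\<And>k. polydisc_series_with (c k) \<rho> (A * B ^ k) (H k)"
    and H: "\<And>k x. x \<in> cube v1 \<eta> \<Longrightarrow> a x k = H k x"
    by metis
  obtain F s where F: "real_analytic_at F 0" and s: "s > 0"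
    "\<And>x. norm x < s \<Longrightarrow> (\<lambda>k. homogeneous_part (c k) k x) sums F x"
    using homogeneous_parts_converge[OF \<rho> B c] by metis
  have homogeneous_part: "homogeneous_part (c k) k v = a v k" if v: "v \<in> cube v1 \<eta>" for v k
  proof -
    have "\<bar>v $ i\<bar> < \<rho>" for i
      using v component_le_norm_cart[of v1 i] unfolding cube_def \<rho>_def by (smt (verit) mem_Collect_eq)
    moreover have "\<forall>\<^sub>F t in nhds 1. H k (t *\<^sub>R v) = t ^ k * H k v"
    proof -
      have "((\<lambda>t. t *\<^sub>R v) \<longlongrightarrow> 1 *\<^sub>R v) (nhds 1)" by (intro tendsto_intros filterlim_ident)
      then have "\<forall>\<^sub>F t in nhds 1. t *\<^sub>R v \<in> cube v1 \<eta>"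
        by (rule topological_tendstoD) (use v open_cube in auto)
      moreover have "\<forall>\<^sub>F t in nhds (1::real). t \<noteq> 0" by (rule t1_space_nhds) simp
      ultimately show ?thesis
      proof eventually_elim
        case (elim t)
        then show ?case using homog[of v t k] H[of v k] H[of "t *\<^sub>R v" k] v sub by auto
      qed
    qed
    ultimately have "homogeneous_part (c k) k v = H k v" by (intro homogeneous_part_eq_of_homogeneous[OF \<rho> c]) auto
    then show ?thesis using H v by simp
  qed
  have "\<forall>\<^sub>F t in nhds 0. g (t *\<^sub>R v) = F (t *\<^sub>R v)" if v: "v \<in> cube v1 \<eta>" for v
    unfolding eventually_nhds_metric
  proof (intro exI[of _ "min (r v) (s / (norm v + 1))"] conjI allI impI)
    show "0 < min (r v) (s / (norm v + 1))" using r v sub s(1) by (auto simp: add_nonneg_pos)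
    fix t :: real assume "dist t 0 < min (r v) (s / (norm v + 1))"
    moreover have "norm v + 1 > 0" by (simp add: add_nonneg_pos)
    ultimately have t: "\<bar>t\<bar> < r v" "\<bar>t\<bar> * (norm v + 1) < s" by (simp_all add: pos_less_divide_eq)
    have "\<bar>t\<bar> * norm v \<le> \<bar>t\<bar> * (norm v + 1)" by (simp add: distrib_left)
    with t(2) have "norm (t *\<^sub>R v) < s" by simp
    from s(2)[OF this] have "(\<lambda>k. a v k * t ^ k) sums F (t *\<^sub>R v)"
      by (simp add: homogeneous_part_scale homogeneous_part[OF v] mult.commute)
    moreover have "(\<lambda>k. a v k * t ^ k) sums g (t *\<^sub>R v)" using a t(1) v sub by blast
    ultimately show "g (t *\<^sub>R v) = F (t *\<^sub>R v)" by (rule sums_unique2[symmetric])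
  qed
  then show thesis by (intro that[OF \<eta> sub F] ballI)
qed

lemma plane_line: "plane u v (vector [0, t]) = t *\<^sub>R v"
  by (simp add: plane_def)

section \<open>Linear change of directions and spreading along rays\<close>

lemma real_analytic_at_linear_image:
  fixes f :: "real^'n \<Rightarrow> real" and T :: "real^'m \<Rightarrow> real^'n"
  assumes "linear T" "real_analytic_at f (T a)"
  shows "real_analytic_at (\<lambda>x. f (T x)) a"
proof (rule real_analytic_at_compose[where \<phi>=T, OF assms(2)])
  fix i
  have "T x $ i = (\<Sum>j\<in>UNIV. x $ j * T (axis j 1) $ i)" for x
  proof -
    have "T x = T (\<Sum>j\<in>UNIV. x $ j *\<^sub>R axis j 1)"
      using basis_expansion[of x] by (simp add: scalar_mult_eq_scaleR)
    also have "\<dots> = (\<Sum>j\<in>UNIV. x $ j *\<^sub>R T (axis j 1))"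
      using assms(1) by (simp add: linear_sum linear_cmul)
    finally show ?thesis by simp
  qed
  then have "(\<lambda>x. T x $ i) = (\<lambda>x. \<Sum>j\<in>UNIV. x $ j * T (axis j 1) $ i)" by (rule ext)
  then show "real_analytic_at (\<lambda>x. T x $ i) a"
    by (rule ssubst) (intro real_analytic_at_intros)
qed

text \<open>Here only planes with one spanning vector near \<open>m\<close> are available, whereas
  the proposition asks for all coordinate axes. A linear isomorphism that moves every axis close to
  \<open>m\<close> reconciles the two.\<close>

lemma analytic_extension_from_nearby_planes:
  fixes g :: "real^'n \<Rightarrow> real"
  assumes "\<delta> > 0"
    and an: "\<And>u v. dist u m < \<delta> \<Longrightarrow> dist v v0 < \<delta> \<Longrightarrow> real_analytic_at (\<lambda>x. g (plane u v x)) 0"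
  obtains F W where "open W" "W \<noteq> {}" "W \<subseteq> ball v0 \<delta>" "real_analytic_at F 0"
    "\<forall>v\<in>W. \<forall>\<^sub>F t in nhds 0. g (t *\<^sub>R v) = F (t *\<^sub>R v)"
proof -
  define tr where "tr x = (\<Sum>i\<in>UNIV. x $ i)" for x :: "real^'n"
  have tr: "linear tr" by (rule linearI) (simp_all add: tr_def sum.distrib sum_distrib_left)
  \<comment> \<open>The map \<open>T\<close> below is a rank-one perturbation of multiplication by
    \<open>\<kappa>\<close>, and \<open>tr m + \<kappa> \<noteq> 0\<close> makes it invertible. At
    least one of \<open>\<delta> / 2\<close> and \<open>\<delta> / 3\<close> meets this
    condition.\<close>
  obtain \<kappa> where \<kappa>: "0 < \<kappa>" "\<kappa> < \<delta>" "tr m + \<kappa> \<noteq> 0"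
  proof (cases "tr m + \<delta> / 2 = 0")
    case True
    then show ?thesis using that[of "\<delta> / 3"] assms(1) by simp
  next
    case False
    then show ?thesis using that[of "\<delta> / 2"] assms(1) by simp
  qed
  \<comment> \<open>\<open>T\<close> is an isomorphism that maps every coordinate axis to a direction close to \<open>m\<close>.\<close>
  define T where "T s = tr s *\<^sub>R m + \<kappa> *\<^sub>R s" for s
  \<comment> \<open>The Sherman-Morrison inverse: \<open>T\<close> multiplies \<open>tr\<close> by
    \<open>tr m + \<kappa>\<close>, so \<open>tr\<close> of the preimage is known first and the rest
    follows.\<close>
  define T' where "T' w = (1 / \<kappa>) *\<^sub>R (w - (tr w / (tr m + \<kappa>)) *\<^sub>R m)" for w
  have T: "linear T"
    using tr by (intro linearI) (simp_all add: T_def linear_add linear_cmul algebra_simps)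
  have T': "linear T'"
    using tr by (intro linearI) (simp_all add: T'_def linear_add linear_cmul algebra_simps add_divide_distrib)
  have TT': "T (T' w) = w" for w
  proof -
    have "tr (T' w) = (1 / \<kappa>) * (tr w - (tr w / (tr m + \<kappa>)) * tr m)"
      using tr by (simp add: T'_def linear_cmul linear_diff diff_divide_distrib)
    also have "\<dots> = tr w / (tr m + \<kappa>)" using \<kappa> by (simp add: field_simps)
    finally show ?thesis using \<kappa> by (simp add: T_def) (simp add: T'_def)
  qed
  have T'T: "T' (T s) = s" for s
  proof -
    have "tr (T s) = tr s * (tr m + \<kappa>)"
      using tr by (simp add: T_def linear_cmul linear_add algebra_simps)
    then show ?thesis using \<kappa> by (simp add: T'_def) (simp add: T_def)
  qed
  have "isCont T (T' v0)" using T linear_continuous_at linear_conv_bounded_linear by blast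
  then obtain e where e: "e > 0" "\<And>s. dist s (T' v0) < e \<Longrightarrow> dist (T s) v0 < \<delta>"
    using assms(1) unfolding continuous_at_eps_delta TT' by blast
  define \<epsilon> where "\<epsilon> = e / (2 * CARD('n))"
  have "\<epsilon> > 0" using e(1) by (simp add: \<epsilon>_def)
  have near: "dist (T s) v0 < \<delta>" if "s \<in> cube (T' v0) \<epsilon>" for s
    using cube_subset_ball[OF e(1), of "T' v0"] that e(2)[of s] by (auto simp: \<epsilon>_def dist_commute)
  have an': "real_analytic_at (\<lambda>x. g (T (plane (axis j 1) s x))) 0" if "s \<in> cube (T' v0) \<epsilon>" for s j
  proof -
    have "T (axis j 1) = m + \<kappa> *\<^sub>R axis j 1"
      by (simp add: T_def tr_def axis_def)
    then have "dist (T (axis j 1)) m < \<delta>" using \<kappa> by (simp add: dist_norm)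
    from an[OF this near[OF that]] show ?thesis
      using T by (simp add: plane_def linear_add linear_cmul)
  qed
  obtain F v1 \<eta> where \<eta>: "\<eta> > 0" "cube v1 \<eta> \<subseteq> cube (T' v0) \<epsilon>" and F: "real_analytic_at F 0"
    and eq: "\<forall>s\<in>cube v1 \<eta>. \<forall>\<^sub>F t in nhds 0. g (T (t *\<^sub>R s)) = F (t *\<^sub>R s)"
    by (rule analytic_extension_from_planes[OF \<open>\<epsilon> > 0\<close>, of "T' v0" "\<lambda>x. g (T x)", OF an'])
  show thesis
  proof (rule that[of "T' -` cube v1 \<eta>" "\<lambda>x. F (T' x)"])
    have "continuous_on UNIV T'" using T' by (simp add: linear_continuous_on linear_conv_bounded_linear)
    then show "open (T' -` cube v1 \<eta>)" by (rule open_vimage[OF open_cube])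
    have "v1 \<in> cube v1 \<eta>" using \<eta>(1) by (simp add: cube_def)
    then show "T' -` cube v1 \<eta> \<noteq> {}" using T'T by (metis empty_iff vimageI)
    show "T' -` cube v1 \<eta> \<subseteq> ball v0 \<delta>"
    proof
      fix w assume "w \<in> T' -` cube v1 \<eta>"
      then have "dist (T (T' w)) v0 < \<delta>" using \<eta>(2) by (intro near) auto
      then show "w \<in> ball v0 \<delta>" by (simp add: TT' dist_commute)
    qed
    show "real_analytic_at (\<lambda>x. F (T' x)) 0"
      by (rule real_analytic_at_linear_image[OF T']) (use F T' in \<open>simp add: linear_0\<close>)
    show "\<forall>v\<in>T' -` cube v1 \<eta>. \<forall>\<^sub>F t in nhds 0. g (t *\<^sub>R v) = F (T' (t *\<^sub>R v))"
    proof
      fix v assume "v \<in> T' -` cube v1 \<eta>"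
      then have "T' v \<in> cube v1 \<eta>" by simp
      from bspec[OF eq this] show "\<forall>\<^sub>F t in nhds 0. g (t *\<^sub>R v) = F (T' (t *\<^sub>R v))"
        using T T' by (simp add: linear_cmul TT')
    qed
  qed
qed

text \<open>So far \<open>g = F\<close> holds near 0 on each ray, with a radius depending on the
  ray. As \<open>g\<close> is analytic along the whole line and \<open>F\<close> on a ball, the
  identity theorem extends the equality to all of the cone inside the ball, which contains an open
  set.\<close>

lemma analytic_extension_near_ray:
  fixes g :: "real^'n \<Rightarrow> real"
  assumes "\<delta> > 0" "r0 > 0"
    and an: "\<And>u v a. dist u m < \<delta> \<Longrightarrow> dist v v0 < \<delta> \<Longrightarrow> real_analytic_at (\<lambda>x. g (plane u v x)) a"
  obtains F r U t v where "0 < r" "r \<le> r0" "\<forall>x\<in>ball 0 r. real_analytic_at F x"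
    "open U" "t *\<^sub>R v \<in> U" "U \<subseteq> ball 0 r" "\<forall>x\<in>U. g x = F x" "g 0 = F 0" "t \<noteq> 0" "dist v v0 < \<delta>"
proof -
  obtain F W where W: "open W" "W \<noteq> {}" "W \<subseteq> ball v0 \<delta>" and F: "real_analytic_at F 0"
    and eq: "\<forall>v\<in>W. \<forall>\<^sub>F t in nhds 0. g (t *\<^sub>R v) = F (t *\<^sub>R v)"
    by (rule analytic_extension_from_nearby_planes[OF assms(1), of m v0 g, OF an])
  have line: "analytic1 (\<lambda>s. g (s *\<^sub>R v)) t" if "v \<in> W" for v t
  proof -
    have "dist v v0 < \<delta>" using that W(3) by (auto simp: dist_commute)
    then have "real_analytic_at (\<lambda>x. g (plane m v x)) (vector [0, t])"
      by (intro an) (use assms(1) in auto)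
    then have "analytic1 (\<lambda>s. g (plane m v (vector [0, s]))) t"
    proof (rule analytic1_curve[where f="\<lambda>x. g (plane m v x)" and \<gamma>="\<lambda>s. vector [0, s]"])
      show "analytic1 (\<lambda>s. (vector [0, s] :: real^2) $ i) t" for i
        using exhaust_2[of i] by (auto simp: analytic1_def intro!: real_analytic_at_intros)
    qed
    then show ?thesis by (simp add: plane_line)
  qed
  obtain r1 where r1: "r1 > 0" "\<And>x. x \<in> ball 0 r1 \<Longrightarrow> real_analytic_at F x"
    using real_analytic_at_nearby[OF F] by metis
  define r where "r = min r0 r1"
  have r: "0 < r" "r \<le> r0" "\<forall>x\<in>ball 0 r. real_analytic_at F x"
    using r1 assms(2) by (auto simp: r_def)
  obtain v where v: "v \<in> W" using W(2) by blast
  define t where "t = r / (norm v + 1)"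
  have t: "t > 0" using r(1) by (simp add: t_def add_nonneg_pos)
  \<comment> \<open>The part in the ball of \<open>W\<close> scaled by \<open>t\<close>, open
    because it has one fixed scaling factor.\<close>
  define U where "U = ball 0 r \<inter> (\<lambda>w. (1 / t) *\<^sub>R w) -` W"
  have "open U" unfolding U_def
    by (intro open_Int open_ball open_vimage W(1) continuous_intros)
  have "norm v / (norm v + 1) < 1" by (simp add: divide_less_eq add_nonneg_pos)
  then have "r * (norm v / (norm v + 1)) < r * 1" using r(1) by (intro mult_strict_left_mono)
  moreover have "norm v + 1 \<noteq> 0" by (smt (verit) norm_ge_zero)
  ultimately have tv: "t *\<^sub>R v \<in> U" using t v r(1) by (simp add: U_def t_def)
  have "g w = F w" if w: "w \<in> U" for w
  proof -
    define v' where "v' = (1 / t) *\<^sub>R w"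
    have v': "v' \<in> W" "w = t *\<^sub>R v'" using w t by (auto simp: U_def v'_def)
    have 1: "analytic1 (\<lambda>s. F (0 + s *\<^sub>R v')) s" if "s \<in> {0..t}" for s
    proof (rule analytic1_line)
      have "norm (s *\<^sub>R v') \<le> norm w" using that t by (simp add: v'(2) mult_right_mono)
      then show "real_analytic_at F (0 + s *\<^sub>R v')" using w by (intro bspec[OF r(3)]) (auto simp: U_def)
    qed
    have "\<forall>\<^sub>F s in nhds t. g (s *\<^sub>R v') = F (0 + s *\<^sub>R v')"
      using analytic1_identity_eq[of "{0..t}", OF _ line[OF v'(1)] 1, of 0 t] bspec[OF eq v'(1)] t by simp
    from eventually_nhds_x_imp_x[OF this] show ?thesis by (simp add: v'(2))
  qed
  \<comment> \<open>A neighbourhood of 0 includes \<open>t = 0\<close>. Since \<open>g\<close> is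
    not known to be continuous at 0, this value has to be recorded separately.\<close>
  moreover have "g 0 = F 0" using eventually_nhds_x_imp_x[OF bspec[OF eq v]] by simp
  moreover have "U \<subseteq> ball 0 r" by (simp add: U_def)
  moreover have "dist v v0 < \<delta>" using v W(3) by (auto simp: dist_commute)
  ultimately show thesis using t by (intro that[OF r \<open>open U\<close> tv]) auto
qed

subsection \<open>Spheres through the origin\<close>

text \<open>Admissibility means that the affine plane through \<open>y\<close> spanned by \<open>u\<close> and \<open>v\<close> misses the closed
  unit ball; \<open>c\<close> defines a separating hyperplane.\<close>

definition admissible :: "real^'n \<Rightarrow> real^'n \<Rightarrow> real^'n \<Rightarrow> bool" where
  "admissible y u v \<longleftrightarrow> u \<noteq> v \<and> independent {u, v} \<and>
     (\<exists>c. norm c < 1 \<and> c \<bullet> y = 1 \<and> c \<bullet> u = 0 \<and> c \<bullet> v = 0)"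

lemma independent_pair: "u \<noteq> 0 \<Longrightarrow> (\<And>k. v \<noteq> k *\<^sub>R u) \<Longrightarrow> u \<noteq> v \<and> independent {u, v}"
  for u v :: "'a::real_vector"
proof -
  assume u: "u \<noteq> 0" and v: "\<And>k. v \<noteq> k *\<^sub>R u"
  have "v \<notin> span {u}" using v by (auto simp: span_singleton)
  then have "independent (insert v {u})" using u by (simp add: independent_insert)
  moreover have "u \<noteq> v" using v[of 1] by auto
  ultimately show ?thesis by (simp add: insert_commute)
qed

text \<open>Gram-Schmidt makes the separating vector explicit: \<open>Y\<close> is the part of
  \<open>z\<close> orthogonal to \<open>u\<close> and \<open>v\<close>, its norm is the distance of
  the plane from 0, and \<open>c = Y / |Y|^2\<close>. At the orthogonal triple \<open>Y\<close>
  equals \<open>y\<close>, and \<open>norm Y > 1\<close> persists nearby by continuity.\<close>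

lemma admissible_nearby:
  fixes y :: "real^'n"
  assumes "norm y > 1" "m \<noteq> 0" "w \<noteq> 0" "y \<bullet> m = 0" "y \<bullet> w = 0" "m \<bullet> w = 0"
  obtains \<delta> where "\<delta> > 0"
    "\<And>z u v. dist z y < \<delta> \<Longrightarrow> dist u m < \<delta> \<Longrightarrow> dist v w < \<delta> \<Longrightarrow> admissible z u v"
proof -
  define V where "V u v = v - ((v \<bullet> u) / (u \<bullet> u)) *\<^sub>R u" for u v :: "real^'n"
  define Y where "Y z u v = z - ((z \<bullet> u) / (u \<bullet> u)) *\<^sub>R u - ((z \<bullet> V u v) / (V u v \<bullet> V u v)) *\<^sub>R V u v"
    for z u v :: "real^'n"
  have V0: "V m w = w" using assms by (simp add: V_def inner_commute)
  have Y0: "Y y m w = y" using assms by (simp add: Y_def V0)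
  let ?F = "nhds y \<times>\<^sub>F (nhds m \<times>\<^sub>F nhds w)"
  have z: "(fst \<longlongrightarrow> y) ?F" by (rule filterlim_fst)
  have u: "((\<lambda>p. fst (snd p)) \<longlongrightarrow> m) ?F"
    by (rule filterlim_compose[OF filterlim_fst filterlim_snd])
  have v: "((\<lambda>p. snd (snd p)) \<longlongrightarrow> w) ?F"
    by (rule filterlim_compose[OF filterlim_snd filterlim_snd])
  have Vt: "((\<lambda>p. V (fst (snd p)) (snd (snd p))) \<longlongrightarrow> V m w) ?F"
    unfolding V_def by (intro tendsto_intros u v) (use assms in simp)
  have Yt: "((\<lambda>p. Y (fst p) (fst (snd p)) (snd (snd p))) \<longlongrightarrow> Y y m w) ?F"
    unfolding Y_def by (intro tendsto_intros z u v Vt) (use assms V0 in simp_all)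
  have "\<forall>\<^sub>F p in ?F. fst (snd p) \<noteq> 0"
    by (rule tendsto_imp_eventually_ne[OF u assms(2)])
  moreover have "\<forall>\<^sub>F p in ?F. V (fst (snd p)) (snd (snd p)) \<noteq> 0"
    by (rule tendsto_imp_eventually_ne[OF Vt]) (use V0 assms in simp)
  moreover have "\<forall>\<^sub>F p in ?F. norm (Y (fst p) (fst (snd p)) (snd (snd p))) > 1"
    by (rule order_tendstoD(1)[OF tendsto_norm[OF Yt]]) (use Y0 assms in simp)
  ultimately have "\<forall>\<^sub>F p in ?F. admissible (fst p) (fst (snd p)) (snd (snd p))"
  proof eventually_elim
    case (elim p)
    obtain z u v where p: "p = (z, u, v)" by (metis prod.collapse)
    have u: "u \<noteq> 0" and V: "V u v \<noteq> 0" and Y: "norm (Y z u v) > 1" using elim by (auto simp: p)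
    have "v \<noteq> k *\<^sub>R u" for k using V u by (auto simp: V_def)
    from independent_pair[OF u this] have "u \<noteq> v \<and> independent {u, v}" .
    moreover have Vu: "V u v \<bullet> u = 0" using u by (simp add: V_def inner_diff_left)
    then have Yu: "Y z u v \<bullet> u = 0" using u by (simp add: Y_def inner_diff_left)
    have YV: "Y z u v \<bullet> V u v = 0"
      using V Vu inner_commute[of u "V u v"] by (simp add: Y_def inner_diff_left)
    have Yv: "Y z u v \<bullet> v = 0"
      using YV Yu by (simp add: V_def inner_diff_right)
    have Yz: "Y z u v \<bullet> z = Y z u v \<bullet> Y z u v"
    proof -
      have "Y z u v \<bullet> Y z u v = Y z u v \<bullet> (z - ((z \<bullet> u) / (u \<bullet> u)) *\<^sub>R u - ((z \<bullet> V u v) / (V u v \<bullet> V u v)) *\<^sub>R V u v)"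
        by (simp add: Y_def)
      then show ?thesis using Yu YV by (simp add: inner_diff_right)
    qed
    define c where "c = (1 / (Y z u v \<bullet> Y z u v)) *\<^sub>R Y z u v"
    have "Y z u v \<noteq> 0" using Y by auto
    then have "c \<bullet> z = 1" "c \<bullet> u = 0" "c \<bullet> v = 0" by (simp_all add: c_def Yz Yu Yv)
    moreover have "norm c < 1"
    proof -
      have "norm c = 1 / norm (Y z u v)"
        by (simp add: c_def dot_square_norm power2_eq_square)
      then show ?thesis using Y by (simp add: divide_less_eq)
    qed
    ultimately show ?case unfolding admissible_def p by auto
  qed
  then have "\<forall>\<^sub>F p in nhds (y, m, w). admissible (fst p) (fst (snd p)) (snd (snd p))"
    by (simp add: nhds_prod)
  then obtain d where d: "d > 0" "\<And>p. dist p (y, m, w) < d \<Longrightarrow> admissible (fst p) (fst (snd p)) (snd (snd p))"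
    unfolding eventually_nhds_metric by blast
  show thesis
  proof (rule that[of "d / 3"])
    fix z u v assume *: "dist z y < d / 3" "dist u m < d / 3" "dist v w < d / 3"
    have "dist (z, u, v) (y, m, w) \<le> dist z y + dist (u, v) (m, w)"
      unfolding dist_Pair_Pair[of z "(u, v)"] by (rule sqrt_sum_squares_le_sum) simp_all
    also have "dist (u, v) (m, w) \<le> dist u m + dist v w"
      unfolding dist_Pair_Pair by (rule sqrt_sum_squares_le_sum) simp_all
    finally have "dist (z, u, v) (y, m, w) < d" using * by simp
    from d(2)[OF this] show "admissible z u v" by simp
  qed (use d(1) in simp)
qed

text \<open>For \<open>c\<close> as in \<open>admissible\<close>, this is the inversion of the
  affine plane \<open>y + span {u, v}\<close>, together with the origin: for nonzero
  \<open>x\<close>, the equation says that \<open>c\<close> takes the value 1 at the inversion of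
  \<open>x\<close>.\<close>

definition plane_sphere :: "real^'n \<Rightarrow> real^'n \<Rightarrow> real^'n \<Rightarrow> real^'n \<Rightarrow> (real^'n) set" where
  "plane_sphere c y u v = {x. x \<bullet> x = c \<bullet> x} \<inter> span {y, u, v}"

text \<open>Replacing \<open>c\<close> by its projection \<open>c'\<close> to the span does not
  change the equation there, and completing the square gives centre \<open>c' / 2\<close> and radius
  \<open>|c'| / 2\<close>. Cauchy-Schwarz yields \<open>|x| \<le> |c| < 1\<close> on the
  sphere.\<close>

lemma plane_sphere_through_origin:
  fixes c y u v :: "real^'n"
  assumes "norm c < 1" "c \<bullet> y = 1" "c \<bullet> u = 0" "c \<bullet> v = 0" "u \<noteq> v" "independent {u, v}"
  shows "two_sphere_through_origin (plane_sphere c y u v)" "plane_sphere c y u v \<subseteq> ball 0 1"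
proof -
  let ?V = "span {y, u, v}" and ?S = "plane_sphere c y u v"
  have perp: "c \<bullet> x = 0" if "x \<in> span {u, v}" for x
    using that
  proof (induction rule: span_induct_alt)
    case (step k z x)
    then show ?case using assms by (auto simp: inner_add_right)
  qed simp
  have "y \<notin> span {u, v}" using perp assms(2) by force
  then have ind: "independent {y, u, v}" and "y \<notin> {u, v}"
    using assms(6) span_base[of _ "{u, v}"] by (auto simp: independent_insert)
  then have card: "card {y, u, v} = 3" using assms(5) by auto
  have dim: "dim ?V = 3" using ind card by (simp add: dim_eq_card_independent)
  obtain c' z where c': "c' \<in> ?V" "\<And>w. w \<in> ?V \<Longrightarrow> orthogonal z w" "c = c' + z"
    using orthogonal_subspace_decomp_exists[of "{y, u, v}" c] by metis
  have cc': "c \<bullet> x = c' \<bullet> x" if "x \<in> ?V" for x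
    using c'(2)[OF that] by (simp add: c'(3) inner_add_left orthogonal_def)
  have "c' \<noteq> 0" using cc'[of y] assms(2) by (auto simp: span_base)
  have eq: "?S = sphere ((1/2) *\<^sub>R c') (norm c' / 2) \<inter> ?V"
  proof -
    have "dist ((1/2) *\<^sub>R c') x = norm c' / 2 \<longleftrightarrow> x \<bullet> x = c' \<bullet> x" for x
    proof -
      have e: "(dist ((1/2) *\<^sub>R c') x)\<^sup>2 = (c' \<bullet> c') / 4 - c' \<bullet> x + x \<bullet> x"
        by (simp add: dist_norm power2_norm_eq_inner inner_diff_left inner_diff_right
            inner_commute[of x c'] field_simps)
      have "(norm c' / 2)\<^sup>2 = (c' \<bullet> c') / 4"
        by (simp add: power_divide power2_norm_eq_inner)
      have "dist ((1/2) *\<^sub>R c') x = norm c' / 2 \<longleftrightarrow> (dist ((1/2) *\<^sub>R c') x)\<^sup>2 = (norm c' / 2)\<^sup>2"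
        by (rule power2_eq_iff_nonneg[symmetric]) simp_all
      also have "\<dots> \<longleftrightarrow> x \<bullet> x = c' \<bullet> x"
        unfolding e \<open>(norm c' / 2)\<^sup>2 = _\<close> by auto
      finally show ?thesis .
    qed
    then show ?thesis by (auto simp: plane_sphere_def cc')
  qed
  have "aff_dim ?V = 3" using dim by (simp add: aff_dim_subspace)
  moreover have "affine ?V" by (simp add: subspace_imp_affine)
  moreover have "(1/2) *\<^sub>R c' \<in> ?V" using c'(1) by (rule span_scale)
  moreover have "norm c' / 2 > 0" using \<open>c' \<noteq> 0\<close> by simp
  ultimately have "round_2_sphere ?S" unfolding round_2_sphere_def using eq by blast
  moreover have "?S = {x. (\<Sum>i\<in>UNIV. (x $ i)\<^sup>2) = (\<Sum>i\<in>UNIV. c $ i * x $ i)} \<inter> ?V"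
    by (simp add: plane_sphere_def inner_vec_def power2_eq_square)
  moreover have "subspace ?V" by simp
  ultimately show "two_sphere_through_origin ?S"
    unfolding two_sphere_through_origin_def using dim by blast
  show "?S \<subseteq> ball 0 1"
  proof
    fix x assume "x \<in> ?S"
    then have "norm x * norm x = c \<bullet> x" by (simp add: plane_sphere_def dot_square_norm power2_eq_square)
    also have "\<dots> \<le> norm c * norm x" by (rule norm_cauchy_schwarz)
    finally have "norm x \<le> norm c" using norm_ge_zero[of c] by (cases "x = 0") auto
    then show "x \<in> ball 0 1" using assms(1) by simp
  qed
qed

lemma restriction_real_analytic_pullback:
  fixes f :: "real^'n \<Rightarrow> real" and \<gamma> :: "real^'m \<Rightarrow> real^'n"
  assumes "restriction_real_analytic f S" "\<And>x. \<gamma> x \<in> S" "\<And>i. real_analytic_at (\<lambda>x. \<gamma> x $ i) a"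
  shows "real_analytic_at (\<lambda>x. f (\<gamma> x)) a"
proof -
  from bspec[OF assms(1)[unfolded restriction_real_analytic_def] assms(2)[of a]]
  obtain U g where U: "open U" "\<gamma> a \<in> U" "real_analytic_on g U" "\<forall>x\<in>S \<inter> U. g x = f x"
    by (elim exE conjE)
  \<comment> \<open>The local extension of \<open>f\<close> agrees with it only on a neighbourhood,
    so \<open>\<gamma>\<close> must map points near \<open>a\<close> into that
    neighbourhood.\<close>
  have "isCont \<gamma> a"
    unfolding isCont_def
    by (rule vec_tendstoI) (use real_analytic_at_isCont[OF assms(3)] in \<open>simp add: isCont_def\<close>)
  from spec[OF iffD1[OF continuous_at_open this], THEN mp, OF conjI[OF U(1,2)]]
  obtain W where W: "open W" "a \<in> W" "\<forall>x\<in>W. \<gamma> x \<in> U"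
    by (elim exE conjE)
  have "real_analytic_at (\<lambda>x. g (\<gamma> x)) a"
    by (rule real_analytic_at_compose[where f=g and \<phi>=\<gamma>, OF _ assms(3)])
       (use U(2,3) in \<open>simp add: real_analytic_on_def\<close>)
  then show ?thesis
    by (rule real_analytic_at_cong_open[OF _ W(1,2)]) (use W(3) U(4) assms(2) in auto)
qed

section \<open>Inversion and translation conjugated by inversion\<close>

definition inversion :: "real^'n \<Rightarrow> real^'n" where
  "inversion x = (1 / (x \<bullet> x)) *\<^sub>R x"

text \<open>The composite of inversion, translation by \<open>y\<close> and inversion, extended to the origin.\<close>

definition conformal :: "real^'n \<Rightarrow> real^'n \<Rightarrow> real^'n" where
  "conformal y w = (1 / (1 + 2 * (y \<bullet> w) + (w \<bullet> w) * (y \<bullet> y))) *\<^sub>R (w + (w \<bullet> w) *\<^sub>R y)"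

lemma inversion_inversion: "inversion (inversion x) = x"
  by (simp add: inversion_def)

lemma real_analytic_at_inner:
  assumes "\<And>i. real_analytic_at (\<lambda>x. p x $ i) a" "\<And>i. real_analytic_at (\<lambda>x. q x $ i) a"
  shows "real_analytic_at (\<lambda>x. p x \<bullet> q x) a"
  unfolding inner_vec_def inner_real_def by (intro real_analytic_at_intros assms)

lemma real_analytic_at_inversion:
  assumes "\<And>i. real_analytic_at (\<lambda>x. p x $ i) a" "p a \<noteq> 0"
  shows "real_analytic_at (\<lambda>x. inversion (p x) $ i) a"
proof -
  have "inversion x $ i = x $ i / (x \<bullet> x)" for x :: "real^'a" by (simp add: inversion_def)
  then show ?thesis
    using real_analytic_at_divide[OF assms(1) real_analytic_at_inner[OF assms(1) assms(1)]] assms(2)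
    by simp
qed

lemma real_analytic_at_conformal:
  assumes "\<And>i. real_analytic_at (\<lambda>x. p x $ i) a" "1 + 2 * (y \<bullet> p a) + (p a \<bullet> p a) * (y \<bullet> y) \<noteq> 0"
  shows "real_analytic_at (\<lambda>x. conformal y (p x) $ i) a"
proof -
  have 1: "conformal y w $ i = (w $ i + (w \<bullet> w) * y $ i) / (1 + 2 * (y \<bullet> w) + (w \<bullet> w) * (y \<bullet> y))" for w
    by (simp add: conformal_def)
  show ?thesis unfolding 1
    by (intro real_analytic_at_divide real_analytic_at_intros real_analytic_at_inner assms)
qed

lemma real_analytic_at_plane: "real_analytic_at (\<lambda>x. plane u v x $ i) a"
  by (simp add: plane_def) (intro real_analytic_at_intros)

lemma plane_in_span: "plane u v x \<in> span {y, u, v}"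
  unfolding plane_def by (intro span_add span_scale span_base) auto

text \<open>Gives the squared length of \<open>conformal y w\<close> as \<open>w \<bullet> w\<close>
  over the denominator, and shows that the denominator is nonzero as soon as the numerator vector
  is.\<close>

lemma conformal_square:
  "(w + (w \<bullet> w) *\<^sub>R y) \<bullet> (w + (w \<bullet> w) *\<^sub>R y) = (w \<bullet> w) * (1 + 2 * (y \<bullet> w) + (w \<bullet> w) * (y \<bullet> y))"
  by (simp add: inner_add_left inner_add_right inner_commute[of w y] algebra_simps)

text \<open>Translations by \<open>y\<close> and \<open>- y\<close> cancel after conjugation. In the
  computation, the denominator at the image point is the reciprocal of the one at \<open>x\<close>,
  so it is nonzero as well.\<close>

lemma conformal_inverse:
  assumes "1 + 2 * ((- y) \<bullet> x) + (x \<bullet> x) * ((- y) \<bullet> (- y)) \<noteq> 0"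
  shows "conformal y (conformal (- y) x) = x"
proof -
  define D where "D = 1 + 2 * ((- y) \<bullet> x) + (x \<bullet> x) * ((- y) \<bullet> (- y))"
  define w where "w = conformal (- y) x"
  have w: "w = (1 / D) *\<^sub>R (x + (x \<bullet> x) *\<^sub>R (- y))" by (simp add: w_def conformal_def D_def)
  have D: "D \<noteq> 0" using assms by (simp add: D_def)
  have "(x + (x \<bullet> x) *\<^sub>R (- y)) \<bullet> (x + (x \<bullet> x) *\<^sub>R (- y)) = (x \<bullet> x) * D"
    unfolding D_def by (rule conformal_square)
  then have "w \<bullet> w = (1 / D) * ((1 / D) * ((x \<bullet> x) * D))"
    by (simp only: w inner_scaleR_left inner_scaleR_right)
  then have ww: "w \<bullet> w = (x \<bullet> x) / D" using D by simp
  have 1: "w + (w \<bullet> w) *\<^sub>R y = (1 / D) *\<^sub>R x"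
    unfolding ww by (simp add: w algebra_simps)
  have "1 + 2 * (y \<bullet> w) + (w \<bullet> w) * (y \<bullet> y) = (D + 2 * (y \<bullet> x - (x \<bullet> x) * (y \<bullet> y)) + (x \<bullet> x) * (y \<bullet> y)) / D"
    unfolding ww using D by (simp add: w inner_diff_right field_simps)
  also have "\<dots> = 1 / D" by (simp add: D_def)
  finally have "conformal y w = x"
    unfolding conformal_def 1 using D by simp
  then show ?thesis by (simp add: w_def)
qed

text \<open>Three dimensions leave room for two directions orthogonal to \<open>y\<close> and to
  each other, hence for a plane through \<open>y\<close> at distance \<open>norm y\<close> from the
  origin.\<close>

lemma orthogonal_pair_exists:
  fixes y :: "real^'n"
  assumes "CARD('n) \<ge> 3"
  obtains m w where "m \<noteq> 0" "w \<noteq> 0" "y \<bullet> m = 0" "y \<bullet> w = 0" "m \<bullet> w = 0"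
proof -
  have "dim {y} < DIM(real^'n)" using dim_le_card'[of "{y}"] assms by simp
  then obtain m where m: "m \<noteq> 0" "\<And>z. z \<in> span {y} \<Longrightarrow> orthogonal m z"
    using orthogonal_to_subspace_exists by metis
  have "dim {y, m} \<le> 2"
    using dim_le_card'[of "{y, m}"] card_insert_le_m1[of 2 "{m}" y] by simp
  then have "dim {y, m} < DIM(real^'n)" using assms by simp
  then obtain w where w: "w \<noteq> 0" "\<And>z. z \<in> span {y, m} \<Longrightarrow> orthogonal w z"
    using orthogonal_to_subspace_exists by metis
  show thesis
    by (rule that[OF m(1) w(1)])
       (use m(2)[of y] w(2)[of y] w(2)[of m] in \<open>auto simp: orthogonal_def inner_commute span_base\<close>)
qed

section \<open>Analyticity away from the origin and at the origin\<close>

context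
  fixes f :: "real^'n \<Rightarrow> real"
  assumes f: "\<And>S. two_sphere_through_origin S \<Longrightarrow> S \<subseteq> ball 0 1 \<Longrightarrow> restriction_real_analytic f S"
begin

text \<open>On the plane \<open>c\<close> is constantly 1, so the plane avoids 0 and inversion maps
  it analytically into the sphere \<open>plane_sphere c y u v\<close>, where the hypothesis on
  \<open>f\<close> applies.\<close>

lemma analytic_inversion_plane:
  assumes "admissible y u v"
  shows "real_analytic_at (\<lambda>x. f (inversion (y + plane u v x))) a"
proof -
  obtain c where c: "norm c < 1" "c \<bullet> y = 1" "c \<bullet> u = 0" "c \<bullet> v = 0" "u \<noteq> v" "independent {u, v}"
    using assms by (auto simp: admissible_def)
  have cz: "c \<bullet> (y + plane u v x) = 1" for x using c by (simp add: plane_def inner_add_right)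
  then have z0: "y + plane u v x \<noteq> 0" for x by (metis inner_zero_right zero_neq_one)
  show ?thesis
  proof (rule restriction_real_analytic_pullback[OF f[OF plane_sphere_through_origin[OF c]]])
    show "inversion (y + plane u v x) \<in> plane_sphere c y u v" for x
    proof -
      have "inversion (y + plane u v x) \<in> span {y, u, v}"
        unfolding inversion_def by (intro span_scale span_add plane_in_span span_base) simp
      then show ?thesis using z0[of x] by (simp add: plane_sphere_def inversion_def cz)
    qed
    show "real_analytic_at (\<lambda>x. inversion (y + plane u v x) $ i) a" for i
      by (rule real_analytic_at_inversion[where p="\<lambda>x. y + plane u v x", OF _ z0])
         (simp add: real_analytic_at_intros real_analytic_at_plane)
  qed
qed

text \<open>The same sphere is parametrised by the linear plane of \<open>u\<close> and
  \<open>v\<close>, now with parameter 0 going to the origin. Hence the origin becomes an interior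
  point of the parametrisation.\<close>

lemma analytic_conformal_plane:
  assumes "admissible y u v"
  shows "real_analytic_at (\<lambda>x. f (conformal y (plane u v x))) a"
proof -
  obtain c where c: "norm c < 1" "c \<bullet> y = 1" "c \<bullet> u = 0" "c \<bullet> v = 0" "u \<noteq> v" "independent {u, v}"
    using assms by (auto simp: admissible_def)
  let ?D = "\<lambda>w. 1 + 2 * (y \<bullet> w) + (w \<bullet> w) * (y \<bullet> y)"
  have cw: "c \<bullet> plane u v x = 0" for x using c by (simp add: plane_def inner_add_right)
  have D: "?D (plane u v x) \<noteq> 0" for x
  proof (cases "plane u v x = 0")
    case False
    let ?w = "plane u v x"
    \<comment> \<open>Pairing with \<open>c\<close> shows that the numerator of
      \<open>conformal\<close> is nonzero, hence so is the denominator.\<close>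
    have "c \<bullet> (?w + (?w \<bullet> ?w) *\<^sub>R y) = ?w \<bullet> ?w" using cw c by (simp add: inner_add_right)
    then have "?w + (?w \<bullet> ?w) *\<^sub>R y \<noteq> 0" using False by (metis inner_eq_zero_iff inner_zero_right)
    then show ?thesis using conformal_square[of ?w y] by auto
  qed simp
  show ?thesis
  proof (rule restriction_real_analytic_pullback[OF f[OF plane_sphere_through_origin[OF c]]])
    show "conformal y (plane u v x) \<in> plane_sphere c y u v" for x
    proof -
      let ?w = "plane u v x"
      have "conformal y ?w \<in> span {y, u, v}"
        unfolding conformal_def by (intro span_scale span_add plane_in_span span_base) simp
      moreover have "conformal y ?w \<bullet> conformal y ?w = (?w \<bullet> ?w) / ?D ?w"
        using D[of x] conformal_square[of ?w y] by (simp add: conformal_def)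
      moreover have "c \<bullet> conformal y ?w = (?w \<bullet> ?w) / ?D ?w"
        using cw c by (simp add: conformal_def inner_add_right)
      ultimately show ?thesis by (simp add: plane_sphere_def)
    qed
    show "real_analytic_at (\<lambda>x. conformal y (plane u v x) $ i) a" for i
      by (rule real_analytic_at_conformal[OF real_analytic_at_plane D])
  qed
qed


text \<open>The extension \<open>F\<close> is built at \<open>y\<close>, the inversion of
  \<open>p\<close>. The equality with \<open>g\<close> spreads from the open set \<open>U\<close> to
  a full neighbourhood along segments from one point \<open>q\<close> of \<open>U\<close>, each
  contained in an admissible plane.\<close>

lemma analytic_off_origin:
  assumes "CARD('n) \<ge> 3" "p \<noteq> 0" "norm p < 1"
  shows "real_analytic_at f p"
proof -
  define y where "y = inversion p"
  have "norm y = 1 / norm p"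
    by (simp add: y_def inversion_def dot_square_norm power2_eq_square)
  then have y: "norm y > 1" using assms by (simp add: less_divide_eq)
  obtain m w where mw: "m \<noteq> 0" "w \<noteq> 0" "y \<bullet> m = 0" "y \<bullet> w = 0" "m \<bullet> w = 0"
    using orthogonal_pair_exists[OF assms(1)] by metis
  obtain \<delta> where \<delta>: "\<delta> > 0"
    and adm: "\<And>z u v. dist z y < \<delta> \<Longrightarrow> dist u m < \<delta> \<Longrightarrow> dist v w < \<delta> \<Longrightarrow> admissible z u v"
    using admissible_nearby[OF y mw] by metis
  define g where "g z = f (inversion (y + z))" for z
  have an: "real_analytic_at (\<lambda>x. g (plane u v x)) a" if "dist u m < \<delta>" "dist v w < \<delta>" for u v a
    unfolding g_def by (rule analytic_inversion_plane[OF adm]) (use that \<delta> in simp_all)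
  obtain F r U t v where r: "0 < r" "r \<le> 1" "\<forall>x\<in>ball 0 r. real_analytic_at F x"
    and U: "open U" "t *\<^sub>R v \<in> U" "U \<subseteq> ball 0 r" "\<forall>x\<in>U. g x = F x" "g 0 = F 0"
    and tv: "t \<noteq> 0" "dist v w < \<delta>"
    by (rule analytic_extension_near_ray[OF \<delta> zero_less_one, of m w g, OF an])
  define q where "q = t *\<^sub>R v"
  \<comment> \<open>For \<open>x\<close> this close to 0, the segment lies where \<open>F\<close> is
    analytic, \<open>y + x\<close> is within \<open>\<delta>\<close> of \<open>y\<close>, and the
    rescaled direction \<open>v'\<close> from \<open>x\<close> to \<open>q\<close> is within
    \<open>\<delta>\<close> of \<open>w\<close>.\<close>
  define \<rho> where "\<rho> = min r (min \<delta> (\<bar>t\<bar> * (\<delta> - dist v w)))"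
  have "\<rho> > 0" using r(1) \<delta> tv by (simp add: \<rho>_def)
  have gF: "F x = g x" if x: "x \<in> ball 0 \<rho>" for x
  proof -
    define v' where "v' = (1 / t) *\<^sub>R (q - x)"
    have "dist v' w \<le> dist v' v + dist v w" by (rule dist_triangle)
    also have "dist v' v = norm x / \<bar>t\<bar>"
      using tv(1) by (simp add: v'_def q_def dist_norm algebra_simps)
    also have "\<dots> < \<delta> - dist v w"
      using x tv(1) by (simp add: \<rho>_def divide_less_eq mult.commute)
    finally have v': "dist v' w < \<delta>" by simp
    have adm': "admissible (y + x) m v'"
      by (rule adm[OF _ _ v']) (use x \<delta> in \<open>auto simp: \<rho>_def dist_norm\<close>)
    \<comment> \<open>The whole line through \<open>x\<close> and \<open>q\<close>, shifted by
      \<open>y\<close>, lies in the plane based at \<open>y + x\<close>, not \<open>y\<close>; this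
      is why admissibility was made stable in the base point too.\<close>
    have eq: "y + (q + s *\<^sub>R (x - q)) = y + x + plane m v' (vector [0, (1 - s) * t])" for s
      using tv(1) by (simp add: plane_line v'_def algebra_simps)
    have 1: "analytic1 (\<lambda>s. g (q + s *\<^sub>R (x - q))) s" for s
      unfolding g_def eq
    proof (rule analytic1_curve[where f="\<lambda>z. f (inversion (y + x + plane m v' z))" and \<gamma>="\<lambda>s. vector [0, (1 - s) * t]"])
      show "real_analytic_at (\<lambda>z. f (inversion (y + x + plane m v' z))) (vector [0, (1 - s) * t])"
        by (rule analytic_inversion_plane[OF adm'])
      show "analytic1 (\<lambda>s. (vector [0, (1 - s) * t] :: real^2) $ i) s" for i
        using exhaust_2[of i] by (auto simp: analytic1_def intro!: real_analytic_at_intros)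
    qed
    have 2: "analytic1 (\<lambda>s. F (q + s *\<^sub>R (x - q))) s" if "s \<in> {0..1}" for s
    proof (rule analytic1_line)
      have "(1 - s) *\<^sub>R q + s *\<^sub>R x \<in> ball 0 r"
        by (rule convexD[OF convex_ball]) (use U x that in \<open>auto simp: q_def \<rho>_def\<close>)
      moreover have "q + s *\<^sub>R (x - q) = (1 - s) *\<^sub>R q + s *\<^sub>R x" by (simp add: algebra_simps)
      ultimately show "real_analytic_at F (q + s *\<^sub>R (x - q))" using r(3) by simp
    qed
    have "g (q + (x - q)) = F (q + (x - q))"
      by (rule segment_identity[OF 1 2 U(1)]) (use U in \<open>auto simp: q_def\<close>)
    then show ?thesis by simp
  qed
  have "real_analytic_at F 0" using r by simp
  then have g0: "real_analytic_at g 0"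
    by (rule real_analytic_at_cong[OF _ \<open>\<rho> > 0\<close> gF])
  have "real_analytic_at (\<lambda>x. g (inversion x - y)) p"
  proof (rule real_analytic_at_compose[where f=g and \<phi>="\<lambda>x. inversion x - y"])
    show "real_analytic_at g (inversion p - y)" using g0 by (simp add: y_def)
    show "real_analytic_at (\<lambda>x. (inversion x - y) $ i) p" for i
      unfolding vector_minus_component
      by (intro real_analytic_at_intros real_analytic_at_inversion assms(2))
  qed
  then show ?thesis by (simp add: g_def inversion_inversion)
qed

lemma analytic_at_origin:
  assumes "CARD('n) \<ge> 3"
  shows "real_analytic_at f 0"
proof -
  \<comment> \<open>Any vector of norm greater than 1 would do; this one is twice an arbitrary axis
    vector.\<close>
  define y :: "real^'n" where "y = 2 *\<^sub>R axis undefined 1"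
  have y: "norm y > 1" by (simp add: y_def)
  obtain m w where mw: "m \<noteq> 0" "w \<noteq> 0" "y \<bullet> m = 0" "y \<bullet> w = 0" "m \<bullet> w = 0"
    using orthogonal_pair_exists[OF assms(1)] by metis
  obtain \<delta> where \<delta>: "\<delta> > 0"
    and adm: "\<And>z u v. dist z y < \<delta> \<Longrightarrow> dist u m < \<delta> \<Longrightarrow> dist v w < \<delta> \<Longrightarrow> admissible z u v"
    using admissible_nearby[OF y mw] by metis
  define g where "g z = f (conformal y z)" for z
  have an: "real_analytic_at (\<lambda>x. g (plane u v x)) a" if "dist u m < \<delta>" "dist v w < \<delta>" for u v a
    unfolding g_def by (rule analytic_conformal_plane[OF adm]) (use that \<delta> in simp_all)
  have sq: "((\<lambda>x::real^'n. x \<bullet> x) \<longlongrightarrow> (0::real^'n) \<bullet> 0) (nhds 0)"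
    by (rule tendsto_inner[OF filterlim_ident filterlim_ident])
  have D: "((\<lambda>x. 1 + 2 * (z \<bullet> x) + (x \<bullet> x) * (z \<bullet> z)) \<longlongrightarrow> 1 + 2 * (z \<bullet> 0) + ((0::real^'n) \<bullet> 0) * (z \<bullet> z)) (nhds 0)"
    for z :: "real^'n" by (intro tendsto_add tendsto_mult tendsto_inner tendsto_const filterlim_ident)
  have D0: "\<forall>\<^sub>F x in nhds 0. 1 + 2 * (z \<bullet> x) + (x \<bullet> x) * (z \<bullet> z) \<noteq> 0" for z :: "real^'n"
    by (rule tendsto_imp_eventually_ne[OF D]) simp
  have lim: "(conformal y \<longlongrightarrow> conformal y 0) (nhds 0)"
    unfolding conformal_def by (intro tendsto_scaleR tendsto_divide tendsto_add tendsto_const sq D filterlim_ident) simp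
  have "\<forall>\<^sub>F x in nhds 0. norm (conformal y x) < 1"
    by (rule order_tendstoD(2)[OF tendsto_norm[OF lim]]) (simp add: conformal_def)
  with D0[of y] have "\<forall>\<^sub>F x in nhds 0. 1 + 2 * (y \<bullet> x) + (x \<bullet> x) * (y \<bullet> y) \<noteq> 0 \<and> norm (conformal y x) < 1"
    by (rule eventually_conj)
  then obtain r0 where r0: "r0 > 0"
    "\<And>x. norm x < r0 \<Longrightarrow> 1 + 2 * (y \<bullet> x) + (x \<bullet> x) * (y \<bullet> y) \<noteq> 0 \<and> norm (conformal y x) < 1"
    unfolding eventually_nhds_metric by auto
  obtain F r U t v where r: "0 < r" "r \<le> r0" "\<forall>x\<in>ball 0 r. real_analytic_at F x"
    and U: "open U" "t *\<^sub>R v \<in> U" "U \<subseteq> ball 0 r" "\<forall>x\<in>U. g x = F x" "g 0 = F 0"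
    and "t \<noteq> 0" "dist v w < \<delta>"
    by (rule analytic_extension_near_ray[OF \<delta> r0(1), of m w g, OF an])
  have g: "real_analytic_at g x" if "x \<in> ball 0 r" "x \<noteq> 0" for x
  proof -
    have x: "1 + 2 * (y \<bullet> x) + (x \<bullet> x) * (y \<bullet> y) \<noteq> 0" "norm (conformal y x) < 1"
      using r0(2)[of x] that r(2) by auto
    have "x + (x \<bullet> x) *\<^sub>R y \<noteq> 0"
      using conformal_square[of x y] x(1) that(2) by auto
    then have "conformal y x \<noteq> 0" using x(1) by (simp add: conformal_def)
    from analytic_off_origin[OF assms this x(2)] show ?thesis
      unfolding g_def
      by (rule real_analytic_at_compose[where f=f and \<phi>="conformal y"])
         (rule real_analytic_at_conformal[OF real_analytic_at_component x(1)])
  qed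
  have gF: "F x = g x" if x: "x \<in> ball 0 r" for x
  proof (cases "x = 0")
    case True
    then show ?thesis using U by simp
  next
    case False
    \<comment> \<open>An open set does not fit into a line, so \<open>U\<close> contains a starting
      point \<open>q\<close> off the line through 0 and \<open>x\<close>. The segment from
      \<open>q\<close> to \<open>x\<close> then avoids 0.\<close>
    have "dim (span {x}) \<le> 1" using dim_le_card'[of "{x}"] by simp
    then have "interior (span {x}) = {}" using assms by (intro empty_interior_lowdim) simp
    then have "\<not> U \<subseteq> span {x}" using interior_maximal[OF _ U(1)] U(2) by blast
    then obtain q where q: "q \<in> U" "q \<notin> span {x}" by blast
    have seg: "q + s *\<^sub>R (x - q) \<in> ball 0 r" "q + s *\<^sub>R (x - q) \<noteq> 0" if s: "s \<in> {0..1}" for s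
    proof -
      have eq: "q + s *\<^sub>R (x - q) = (1 - s) *\<^sub>R q + s *\<^sub>R x" by (simp add: algebra_simps)
      show "q + s *\<^sub>R (x - q) \<in> ball 0 r"
        unfolding eq by (rule convexD[OF convex_ball]) (use U q x s in auto)
      show "q + s *\<^sub>R (x - q) \<noteq> 0"
      proof
        assume "q + s *\<^sub>R (x - q) = 0"
        then have 0: "(1 - s) *\<^sub>R q = (- s) *\<^sub>R x" using eq by (simp add: add_eq_0_iff2)
        show False
        proof (cases "s = 1")
          case True
          then show False using 0 False by simp
        next
          case ne: False
          have "(1 - s) *\<^sub>R q \<in> span {x}" unfolding 0 by (intro span_scale span_base) simp
          from span_scale[OF this, of "1 / (1 - s)"] show False using q(2) ne by simp
        qed
      qed
    qed
    have "g (q + (x - q)) = F (q + (x - q))"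
      by (rule segment_identity[OF analytic1_line[OF g] analytic1_line U(1) q(1)])
         (use seg r(3) U(4) in auto)
    then show ?thesis by simp
  qed
  have "real_analytic_at F 0" using r by simp
  then have g0: "real_analytic_at g 0"
    by (rule real_analytic_at_cong[OF _ r(1) gF])
  have comp: "real_analytic_at (\<lambda>x. g (conformal (- y) x)) 0"
  proof (rule real_analytic_at_compose[where f=g and \<phi>="conformal (- y)"])
    show "real_analytic_at g (conformal (- y) 0)" using g0 by (simp add: conformal_def)
    show "real_analytic_at (\<lambda>x. conformal (- y) x $ i) 0" for i
      by (intro real_analytic_at_conformal real_analytic_at_component) simp
  qed
  obtain W where W: "open W" "0 \<in> W"
    "\<And>x. x \<in> W \<Longrightarrow> 1 + 2 * ((- y) \<bullet> x) + (x \<bullet> x) * ((- y) \<bullet> (- y)) \<noteq> 0"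
    using D0[of "- y"] unfolding eventually_nhds by blast
  show ?thesis
    \<comment> \<open>Near 0 the chart \<open>conformal y\<close> is undone by
      \<open>conformal (- y)\<close>, so the composite is \<open>f\<close> itself.\<close>
    by (rule real_analytic_at_cong_open[OF comp W(1,2)]) (simp only: g_def conformal_inverse[OF W(3)])
qed

end

theorem theorem2:
  fixes f :: "real ^ 'n \<Rightarrow> real"
  assumes "CARD('n) \<ge> 3"
    and "\<And>S. two_sphere_through_origin S \<Longrightarrow> S \<subseteq> ball 0 1 \<Longrightarrow> restriction_real_analytic f S"
  shows "real_analytic_on f (ball 0 1)"
  unfolding real_analytic_on_def
proof
  fix p :: "real^'n" assume "p \<in> ball 0 1"
  then show "real_analytic_at f p"
    using analytic_at_origin[OF assms(2,1)] analytic_off_origin[OF assms(2,1), of p]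
    by (cases "p = 0") auto
qed

end
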